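(* Let $R$ be an $F$-finite reduced ring and $M$ a finitely generated $R$-module whose support is equal to the support of $R$ (that is, $\operatorname{Supp} M=\operatorname{Spec} R$). Then $M_* = \tau(M, \mathscr{C}_M)$. In particular, $\tau(M, \mathscr{C}_M)$ exists.
   Context: Rings are commutative Noetherian of prime characteristic $p>0$. A ring is $F$-finite if its Frobenius endomorphism is a finite map. $R^\circ$ is the set of elements of $R$ not contained in any minimal prime. For an $R$-module $M$ and $e\ge 0$, ${}^eM=\{{}^ex : x\in M\}$ is $M$ as an abelian group, with $R$-module structure $r\cdot{}^ex={}^e(r^{p^e}x)$; for a subset $N\subseteq M$, ${}^eN=\{{}^ex: x\in N\}$. Tight interior: for $c\in R^\circ$ and $e_0\ge 0$ put $M_*[c,p^{e_0}]=\sum_{e\ge e_0}\operatorname{im}(\operatorname{Hom}_R({}^eR,M)\to M,\ g\mapsto g({}^ec))$, and $M_*=\bigcap_{c\in R^\circ}\bigcap_{e_0\ge0}M_*[c,p^{e_0}]$. Full Cartier algebra: $\mathscr{C}_M=R\oplus\bigoplus_{e\ge1}\operatorname{Hom}_R({}^eM,M)$, graded with $\mathscr{C}^0_M=R$ and $\mathscr{C}^e_M=\operatorname{Hom}_R({}^eM,M)$ for $e\geq 1$, with multiplication $\phi\cdot\psi=\phi\circ({}^e\psi)$ for $\phi\in\mathscr{C}_M^e$, $\psi\in\mathscr{C}_M^d$. For a submodule $N\subseteq M$ let $\mathscr{C}_M^+\cdot N=\sum_{e\ge1}\sum_{\phi\in\mathscr{C}_M^e}\phi({}^eN)$. A submodule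 $N$ is $\mathscr{C}_M$-compatible if $\phi({}^eN)\subseteq N$ for all $e\ge0$ and $\phi\in\mathscr{C}_M^e$. It is known (Blickle) that the descending chain $M\supseteq\mathscr{C}_M^+\cdot M\supseteq\mathscr{C}_M^+\cdot(\mathscr{C}_M^+\cdot M)\supseteq\cdots$ stabilizes when $M$ is finitely generated; $\underline{M}$ denotes its stable value. $\tau(M,\mathscr{C}_M)$ denotes, if it exists, the unique smallest $\mathscr{C}_M$-compatible submodule $N$ of $M$ which agrees with $\underline{M}$ at the generic points of $M$, i.e. with $N_{\mathfrak p}=\underline{M}_{\mathfrak p}$ for every minimal associated prime $\mathfrak p$ of $M$. *)

theory Defs
  imports Complex_Main "HOL-Computational_Algebra.Primes"
begin

text \<open>
  The ring \<open>R\<close> is the type \<open>'r\<close>, acting on itself by multiplication; an \<open>R\<close>-module \<open>M\<close> is a type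
  \<open>'m\<close> of class \<open>ab_group_add\<close> with a scalar multiplication \<open>s\<close> satisfying the locale \<open>module\<close>.
  Submodules are the sets satisfying \<open>module.subspace s\<close>, and sums of submodules are spans of unions.
\<close>

definition fin_gen :: "('r::comm_ring_1 \<Rightarrow> 'm::ab_group_add \<Rightarrow> 'm) \<Rightarrow> 'm set \<Rightarrow> bool" where
  "fin_gen s N \<longleftrightarrow> (\<exists>B. finite B \<and> N = module.span s B)"

abbreviation ring_ideal :: "'r::comm_ring_1 set \<Rightarrow> bool" where
  "ring_ideal \<equiv> module.subspace ((*) :: 'r \<Rightarrow> 'r \<Rightarrow> 'r)"

definition noetherian :: "'r::comm_ring_1 itself \<Rightarrow> bool" where
  "noetherian _ \<longleftrightarrow> (\<forall>I :: 'r set. ring_ideal I \<longrightarrow> fin_gen (*) I)"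

definition reduced :: "'r::comm_ring_1 itself \<Rightarrow> bool" where
  "reduced _ \<longleftrightarrow> (\<forall>(x::'r) n. x ^ n = 0 \<longrightarrow> x = 0)"

definition ring_prime :: "'r::comm_ring_1 set \<Rightarrow> bool" where
  "ring_prime P \<longleftrightarrow> ring_ideal P \<and> P \<noteq> UNIV \<and> (\<forall>a b. a * b \<in> P \<longrightarrow> a \<in> P \<or> b \<in> P)"

definition minimal_prime :: "'r::comm_ring_1 set \<Rightarrow> bool" where
  "minimal_prime P \<longleftrightarrow> ring_prime P \<and> (\<forall>Q. ring_prime Q \<and> Q \<subseteq> P \<longrightarrow> Q = P)"

text \<open>The set \<open>R\<^sup>\<circ>\<close>.\<close>

definition ring_circ :: "'r::comm_ring_1 set" where
  "ring_circ = {c. \<forall>P. minimal_prime P \<longrightarrow> c \<notin> P}"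


subsection \<open>Localization, support and associated primes\<close>

text \<open>
  \<open>M\<^sub>P\<close> is the set of classes of pairs \<open>(x, a)\<close>, read as fractions \<open>x / a\<close> with \<open>x \<in> M\<close> and \<open>a \<notin> P\<close>.
  For a submodule \<open>N\<close> of \<open>M\<close>, \<open>loc s P N\<close> consists of the classes in \<open>M\<^sub>P\<close> of fractions with
  numerator in \<open>N\<close>, that is, it is \<open>N\<^sub>P\<close> viewed as a submodule of \<open>M\<^sub>P\<close>.
\<close>

definition loc_rel ::
  "('r::comm_ring_1 \<Rightarrow> 'm::ab_group_add \<Rightarrow> 'm) \<Rightarrow> 'r set \<Rightarrow> (('m \<times> 'r) \<times> ('m \<times> 'r)) set" where
  "loc_rel s P = {((x, a), (y, b)). a \<notin> P \<and> b \<notin> P \<and> (\<exists>u. u \<notin> P \<and> s u (s b x - s a y) = 0)}"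

definition loc ::
  "('r::comm_ring_1 \<Rightarrow> 'm::ab_group_add \<Rightarrow> 'm) \<Rightarrow> 'r set \<Rightarrow> 'm set \<Rightarrow> ('m \<times> 'r) set set" where
  "loc s P N = (N \<times> (- P)) // loc_rel s P"

definition module_supp :: "('r::comm_ring_1 \<Rightarrow> 'm::ab_group_add \<Rightarrow> 'm) \<Rightarrow> 'r set set" where
  "module_supp s = {P. ring_prime P \<and> loc s P UNIV \<noteq> loc s P {0}}"

definition assoc_primes :: "('r::comm_ring_1 \<Rightarrow> 'm::ab_group_add \<Rightarrow> 'm) \<Rightarrow> 'r set set" where
  "assoc_primes s = {P. ring_prime P \<and> (\<exists>x. P = {r. s r x = 0})}"

definition min_assoc_primes :: "('r::comm_ring_1 \<Rightarrow> 'm::ab_group_add \<Rightarrow> 'm) \<Rightarrow> 'r set set" where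
  "min_assoc_primes s = {P \<in> assoc_primes s. \<forall>Q \<in> assoc_primes s. Q \<subseteq> P \<longrightarrow> Q = P}"


subsection \<open>Frobenius twists and tight interior\<close>

text \<open>
  The module \<open>\<^sup>eM\<close> has the same underlying group as \<open>M\<close>, so the element \<open>\<^sup>ex\<close> is represented by \<open>x\<close>,
  the subset \<open>\<^sup>eN\<close> by \<open>N\<close>, and only the scalar multiplication changes. The following notions are
  meant for rings of prime characteristic \<open>p = CHAR('r)\<close>.
\<close>

definition frob_twist ::
  "nat \<Rightarrow> ('r::comm_ring_1 \<Rightarrow> 'm::ab_group_add \<Rightarrow> 'm) \<Rightarrow> 'r \<Rightarrow> 'm \<Rightarrow> 'm" where
  "frob_twist e s r x = s (r ^ (CHAR('r) ^ e)) x"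

definition F_finite :: "'r::comm_ring_1 itself \<Rightarrow> bool" where
  "F_finite _ \<longleftrightarrow> fin_gen (frob_twist 1 ((*) :: 'r \<Rightarrow> 'r \<Rightarrow> 'r)) UNIV"

definition tight_interior_at ::
  "('r::comm_ring_1 \<Rightarrow> 'm::ab_group_add \<Rightarrow> 'm) \<Rightarrow> 'r \<Rightarrow> nat \<Rightarrow> 'm set" where
  "tight_interior_at s c e0 =
     module.span s (\<Union>e\<in>{e0..}. {g c |g. module_hom (frob_twist e (*)) s g})"

definition tight_interior :: "('r::comm_ring_1 \<Rightarrow> 'm::ab_group_add \<Rightarrow> 'm) \<Rightarrow> 'm set" where
  "tight_interior s = (\<Inter>c\<in>ring_circ. \<Inter>e0. tight_interior_at s c e0)"


subsection \<open>Cartier algebras and the test submodule\<close>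

text \<open>
  The Cartier algebra enters only through the action of its homogeneous elements on \<open>M\<close>, so it is
  represented by the family of sets of maps \<open>M \<Rightarrow> M\<close> by which its graded pieces act. An element \<open>r\<close>
  of the degree \<open>0\<close> piece \<open>R\<close> acts as scalar multiplication by \<open>r\<close>; the product of homogeneous
  elements acts as the composition.
\<close>

definition full_cartier ::
  "('r::comm_ring_1 \<Rightarrow> 'm::ab_group_add \<Rightarrow> 'm) \<Rightarrow> nat \<Rightarrow> ('m \<Rightarrow> 'm) set" where
  "full_cartier s e = (if e = 0 then range s else {\<phi>. module_hom (frob_twist e s) s \<phi>})"

definition cartier_plus ::
  "('r::comm_ring_1 \<Rightarrow> 'm::ab_group_add \<Rightarrow> 'm) \<Rightarrow> (nat \<Rightarrow> ('m \<Rightarrow> 'm) set) \<Rightarrow> 'm set \<Rightarrow> 'm set" where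
  "cartier_plus s C N = module.span s (\<Union>e\<in>{1..}. \<Union>\<phi>\<in>C e. \<phi> ` N)"

definition cartier_compatible ::
  "('r::comm_ring_1 \<Rightarrow> 'm::ab_group_add \<Rightarrow> 'm) \<Rightarrow> (nat \<Rightarrow> ('m \<Rightarrow> 'm) set) \<Rightarrow> 'm set \<Rightarrow> bool" where
  "cartier_compatible s C N \<longleftrightarrow> module.subspace s N \<and> (\<forall>e. \<forall>\<phi>\<in>C e. \<phi> ` N \<subseteq> N)"

text \<open>The stable value of the chain \<open>M \<supseteq> C\<^sup>+M \<supseteq> C\<^sup>+(C\<^sup>+M) \<supseteq> \<dots>\<close>.\<close>

definition cartier_stable ::
  "('r::comm_ring_1 \<Rightarrow> 'm::ab_group_add \<Rightarrow> 'm) \<Rightarrow> (nat \<Rightarrow> ('m \<Rightarrow> 'm) set) \<Rightarrow> 'm set" where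
  "cartier_stable s C = (THE N. \<exists>n0. \<forall>n\<ge>n0. (cartier_plus s C ^^ n) UNIV = N)"

definition generically_stable ::
  "('r::comm_ring_1 \<Rightarrow> 'm::ab_group_add \<Rightarrow> 'm) \<Rightarrow> (nat \<Rightarrow> ('m \<Rightarrow> 'm) set) \<Rightarrow> 'm set \<Rightarrow> bool" where
  "generically_stable s C N \<longleftrightarrow>
     (\<forall>P \<in> min_assoc_primes s. loc s P N = loc s P (cartier_stable s C))"

definition is_test_submodule ::
  "('r::comm_ring_1 \<Rightarrow> 'm::ab_group_add \<Rightarrow> 'm) \<Rightarrow> (nat \<Rightarrow> ('m \<Rightarrow> 'm) set) \<Rightarrow> 'm set \<Rightarrow> bool" where
  "is_test_submodule s C N \<longleftrightarrow>
     cartier_compatible s C N \<and> generically_stable s C N \<and>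
     (\<forall>N'. cartier_compatible s C N' \<and> generically_stable s C N' \<longrightarrow> N \<subseteq> N')"

text \<open>Meaningful only if some \<open>N\<close> satisfies \<open>is_test_submodule s C N\<close>; such an \<open>N\<close> is unique.\<close>

definition test_submodule ::
  "('r::comm_ring_1 \<Rightarrow> 'm::ab_group_add \<Rightarrow> 'm) \<Rightarrow> (nat \<Rightarrow> ('m \<Rightarrow> 'm) set) \<Rightarrow> 'm set" where
  "test_submodule s C = (THE N. is_test_submodule s C N)"

end

theory Submission
  imports Defs
begin

text \<open>
  Call a submodule \<open>N\<close> of \<open>M\<close> generically full if \<open>c M \<subseteq> N\<close> for some \<open>c\<close> in \<open>R\<^sup>\<circ>\<close>. The ring
  \<open>R\<close> is reduced, so its localization at a minimal prime is a field, and \<open>M\<close> has full support, so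
  over each of these fields it becomes a nonzero vector space, on which the Cartier operators act
  surjectively. Hence the stable value of the chain \<open>M \<supseteq> C\<^sup>+M \<supseteq> \<dots>\<close> is generically full, the minimal
  associated primes of \<open>M\<close> are the minimal primes of \<open>R\<close>, and agreeing generically with the stable
  value means being generically full. The claim becomes: \<open>M\<^sub>*\<close> is the smallest compatible submodule
  that is generically full. It has three parts.

  \<^item> \<open>M\<^sub>*\<close> is compatible, because composing \<open>\<^sup>eR \<rightarrow> M\<close> with \<open>\<^sup>fM \<rightarrow> M\<close> gives a map \<open>\<^sup>e\<^sup>+\<^sup>fR \<rightarrow> M\<close>
    (\<open>tight_interior_compatible\<close>).

  \<^item> \<open>M\<^sub>*\<close> lies in every compatible \<open>N\<close> with \<open>c M \<subseteq> N\<close>. The maps \<open>h : M \<rightarrow> R\<close> have a combined image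
    that meets \<open>R\<^sup>\<circ>\<close> in some \<open>d\<close>, by full support. A map \<open>g : \<^sup>eR \<rightarrow> M\<close> composed with such an \<open>h\<close>
    is a Cartier operator on \<open>M\<close>, so \<open>g(\<^sup>e(c h(x))) = (g \<circ> h)(\<^sup>e(c x))\<close> lies in \<open>N\<close>; summing gives
    \<open>g(\<^sup>e(c d)) \<in> N\<close> (\<open>tight_interior_least\<close>).

  \<^item> \<open>M\<^sub>*\<close> is generically full, because there is a uniform test element: a single \<open>c\<close> in \<open>R\<^sup>\<circ>\<close> that
    for every \<open>d\<close> in \<open>R\<^sup>\<circ>\<close> is a value \<open>\<phi>(\<^sup>ed)\<close> of some \<open>\<phi> : \<^sup>eR \<rightarrow> R\<close> with \<open>e\<close> as large as desired
    (\<open>test_element\<close>). Its existence takes the place of the fact that a localization of \<open>R\<close> is strongly \<open>F\<close>-regular. By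
    \<open>F\<close>-finiteness \<open>\<^sup>1R\<close> is projective up to a denominator in \<open>R\<^sup>\<circ>\<close> (\<open>generic_dual_basis\<close>). Up to this
    denominator the ideal \<open>I\<^sub>e\<close> of values of all \<open>\<phi> : \<^sup>eR \<rightarrow> R\<close> at \<open>d\<close> then lies in the square of
    \<open>I\<^sub>e\<^sub>+\<^sub>1\<close>. The saturations of these ideals ascend, hence stabilize at an ideal equal to its own
    square up to the denominator; it contains the nonzerodivisor \<open>d\<close>, and Nakayama's lemma leaves
    only the possibility that it contains a power of the denominator.

  That the chain \<open>M \<supseteq> C\<^sup>+M \<supseteq> \<dots>\<close> stabilizes at all (\<open>Cplus_chain_stabilizes\<close>) is shown with the
  ideals \<open>(M\<^sub>n\<^sub>+\<^sub>1 : M\<^sub>n)\<close>. Since \<open>a \<phi>(\<^sup>ex) = \<phi>(\<^sup>e(a\<^sup>q x))\<close> with \<open>q = p\<^sup>e\<close>, these ascend and their stable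
  value is radical; at a minimal prime of this radical ideal the chain would be a strictly descending
  chain in a finite-dimensional vector space.
\<close>

section \<open>Ideals and Noetherian modules\<close>

lemma module_mult: "module ((*) :: 'r::comm_ring_1 \<Rightarrow> 'r \<Rightarrow> 'r)"
  by unfold_locales (simp_all add: algebra_simps)

lemma ring_ideal_iff:
  "ring_ideal (I :: 'r::comm_ring_1 set) \<longleftrightarrow>
     0 \<in> I \<and> (\<forall>x\<in>I. \<forall>y\<in>I. x + y \<in> I) \<and> (\<forall>r. \<forall>x\<in>I. r * x \<in> I)"
  by (auto simp: module.subspace_def[OF module_mult])

lemma ring_idealI:
  fixes I :: "'r::comm_ring_1 set"
  assumes "0 \<in> I" and "\<And>x y. x \<in> I \<Longrightarrow> y \<in> I \<Longrightarrow> x + y \<in> I" and "\<And>r x. x \<in> I \<Longrightarrow> r * x \<in> I"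
  shows "ring_ideal I"
  using assms by (auto simp: ring_ideal_iff)

lemma
  fixes I :: "'r::comm_ring_1 set"
  assumes "ring_ideal I"
  shows ring_ideal_zero: "0 \<in> I"
    and ring_ideal_add: "x \<in> I \<Longrightarrow> y \<in> I \<Longrightarrow> x + y \<in> I"
    and ring_ideal_mult: "x \<in> I \<Longrightarrow> r * x \<in> I"
    and ring_ideal_mult_right: "x \<in> I \<Longrightarrow> x * r \<in> I"
    and ring_ideal_diff: "x \<in> I \<Longrightarrow> y \<in> I \<Longrightarrow> x - y \<in> I"
    and ring_ideal_sum: "(\<And>i. i \<in> A \<Longrightarrow> f i \<in> I) \<Longrightarrow> sum f A \<in> I"
proof -
  show "0 \<in> I" and "x \<in> I \<Longrightarrow> y \<in> I \<Longrightarrow> x + y \<in> I" and "x \<in> I \<Longrightarrow> r * x \<in> I"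
    and "x \<in> I \<Longrightarrow> x * r \<in> I"
    using assms by (auto simp: ring_ideal_iff mult.commute)
  show "x \<in> I \<Longrightarrow> y \<in> I \<Longrightarrow> x - y \<in> I"
    by (rule module.subspace_diff[OF module_mult assms])
  show "(\<And>i. i \<in> A \<Longrightarrow> f i \<in> I) \<Longrightarrow> sum f A \<in> I"
    by (rule module.subspace_sum[OF module_mult assms])
qed

lemma ring_prime_iff:
  "ring_prime P \<longleftrightarrow> ring_ideal P \<and> 1 \<notin> P \<and> (\<forall>a b. a * b \<in> P \<longrightarrow> a \<in> P \<or> b \<in> P)"
proof -
  have "P = UNIV \<longleftrightarrow> 1 \<in> P" if "ring_ideal P"
    using ring_ideal_mult[OF that, of 1] by auto
  then show ?thesis by (auto simp: ring_prime_def)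
qed

lemma
  assumes "ring_prime P"
  shows ring_prime_ideal: "ring_ideal P"
    and ring_prime_one: "1 \<notin> P"
    and ring_prime_mult: "a * b \<in> P \<Longrightarrow> a \<in> P \<or> b \<in> P"
    and ring_prime_mult_notin: "a \<notin> P \<Longrightarrow> b \<notin> P \<Longrightarrow> a * b \<notin> P"
  using assms by (auto simp: ring_prime_iff)

lemma ring_prime_power:
  assumes "ring_prime P" "x ^ n \<in> P"
  shows "x \<in> P"
  using assms(2)
proof (induction n)
  case 0
  then show ?case using ring_prime_one[OF assms(1)] by simp
next
  case (Suc n)
  then show ?case using ring_prime_mult[OF assms(1), of x "x ^ n"] by auto
qed

lemma ring_prime_prod:
  assumes "ring_prime P" "finite S" "\<And>i. i \<in> S \<Longrightarrow> f i \<notin> P"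
  shows "prod f S \<notin> P"
  using assms(2,3)
  by (induction S rule: finite_induct)
     (use ring_prime_one[OF assms(1)] ring_prime_mult_notin[OF assms(1)] in auto)

definition colon ::
  "('r::comm_ring_1 \<Rightarrow> 'm::ab_group_add \<Rightarrow> 'm) \<Rightarrow> 'm set \<Rightarrow> 'm set \<Rightarrow> 'r set" where
  "colon s B A = {r. \<forall>x\<in>A. s r x \<in> B}"

lemma ring_ideal_colon:
  assumes "module s" "module.subspace s B"
  shows "ring_ideal (colon s B A)"
proof -
  interpret module s by fact
  show ?thesis
    using assms(2) unfolding colon_def
    by (intro ring_idealI)
       (auto simp: subspace_0 scale_left_distrib subspace_add subspace_scale simp flip: scale_scale)
qed

lemma noetherian_chain_stabilizes:
  fixes I :: "nat \<Rightarrow> 'r::comm_ring_1 set"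
  assumes "noetherian TYPE('r)" and I: "\<And>n. ring_ideal (I n)" and asc: "\<And>n. I n \<subseteq> I (Suc n)"
  obtains n0 where "\<And>n. n0 \<le> n \<Longrightarrow> I n = I n0"
proof -
  have mono: "I m \<subseteq> I n" if "m \<le> n" for m n
    using lift_Suc_mono_le[of I m n] asc that by auto
  have "ring_ideal (\<Union>n. I n)"
  proof (rule ring_idealI)
    show "0 \<in> (\<Union>n. I n)" using ring_ideal_zero[OF I] by blast
    show "r * x \<in> (\<Union>n. I n)" if "x \<in> (\<Union>n. I n)" for r x
      using that ring_ideal_mult[OF I] by blast
    show "x + y \<in> (\<Union>n. I n)" if xy: "x \<in> (\<Union>n. I n)" "y \<in> (\<Union>n. I n)" for x y
    proof -
      from xy obtain m n where "x \<in> I m" "y \<in> I n" by auto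
      then have "x \<in> I (max m n)" "y \<in> I (max m n)"
        using mono[of m "max m n"] mono[of n "max m n"] by auto
      then show ?thesis using ring_ideal_add[OF I] by blast
    qed
  qed
  then obtain B where B: "finite B" "(\<Union>n. I n) = module.span (*) B"
    using assms(1) by (auto simp: noetherian_def fin_gen_def)
  then have "B \<subseteq> (\<Union>n. I n)" by (simp add: module.span_superset[OF module_mult])
  then have "\<forall>b\<in>B. \<exists>n. b \<in> I n" by auto
  then obtain k where k: "\<And>b. b \<in> B \<Longrightarrow> b \<in> I (k b)" by metis
  define n0 where "n0 = Max (insert 0 (k ` B))"
  have "B \<subseteq> I n0"
  proof
    fix b assume b: "b \<in> B"
    then have "k b \<le> n0" using B(1) by (auto simp: n0_def)
    then show "b \<in> I n0" using k[OF b] mono by auto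
  qed
  then have "(\<Union>n. I n) \<subseteq> I n0"
    using module.span_minimal[OF module_mult _ I] B(2) by auto
  then have "I n = I n0" if "n0 \<le> n" for n using mono[OF that] by auto
  then show ?thesis by (rule that)
qed

lemma noetherian_induct [consumes 2, case_names ideal]:
  fixes I :: "'r::comm_ring_1 set"
  assumes "noetherian TYPE('r)" and "ring_ideal I"
    and step: "\<And>I. ring_ideal I \<Longrightarrow> (\<And>J. ring_ideal J \<Longrightarrow> I \<subset> J \<Longrightarrow> Q J) \<Longrightarrow> Q I"
  shows "Q I"
proof (rule ccontr)
  assume "\<not> Q I"
  have "\<exists>f. \<forall>n. (ring_ideal (f n) \<and> \<not> Q (f n)) \<and> f n \<subset> f (Suc n)"
  proof (rule dependent_nat_choice)
    show "\<exists>x. ring_ideal x \<and> \<not> Q x" using \<open>\<not> Q I\<close> assms(2) by auto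
    show "\<exists>y. (ring_ideal y \<and> \<not> Q y) \<and> x \<subset> y" if "ring_ideal x \<and> \<not> Q x" for x n
      using step[of x] that by blast
  qed
  then obtain f where f: "\<forall>n. (ring_ideal (f n) \<and> \<not> Q (f n)) \<and> f n \<subset> f (Suc n)" ..
  then have "ring_ideal (f n)" "f n \<subseteq> f (Suc n)" for n by blast+
  from noetherian_chain_stabilizes[OF assms(1), of f, OF this]
  obtain n0 where "\<And>n. n0 \<le> n \<Longrightarrow> f n = f n0" by blast
  from this[of "Suc n0"] show False using f by auto
qed

text \<open>
  Induction on the number of generators of \<open>M\<close>: a submodule of \<open>R b + M'\<close> is generated by its
  intersection with \<open>M'\<close> and by lifts of generators of the ideal of its \<open>b\<close>-coefficients.
\<close>

lemma noetherian_submodule_fin_gen: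
  fixes s :: "'r::comm_ring_1 \<Rightarrow> 'm::ab_group_add \<Rightarrow> 'm"
  assumes noeth: "noetherian TYPE('r)" and "module s" and "fin_gen s UNIV"
    and "module.subspace s N"
  shows "fin_gen s N"
proof -
  interpret module s by fact
  have "\<forall>N. subspace N \<and> N \<subseteq> span B \<longrightarrow> fin_gen s N" if "finite B" for B
    using that
  proof (induction B rule: finite_induct)
    case empty
    show ?case
      by (auto simp: fin_gen_def intro!: exI[of _ "{}"] dest: subspace_0)
  next
    case (insert b B)
    show ?case
    proof (intro allI impI, elim conjE)
      fix N assume N: "subspace N" "N \<subseteq> span (insert b B)"
      define I where "I = {r. \<exists>z\<in>span B. s r b + z \<in> N}"
      have "ring_ideal I"
      proof (rule ring_idealI)
        show "0 \<in> I" using N(1) by (auto simp: I_def intro!: bexI[of _ 0] span_zero subspace_0)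
        fix x y assume "x \<in> I" "y \<in> I"
        then obtain z w where "z \<in> span B" "w \<in> span B" "s x b + z \<in> N" "s y b + w \<in> N"
          by (auto simp: I_def)
        moreover have "s (x + y) b + (z + w) = (s x b + z) + (s y b + w)"
          by (simp add: scale_left_distrib)
        ultimately have "s (x + y) b + (z + w) \<in> N" "z + w \<in> span B"
          using subspace_add[OF N(1)] span_add[of z B w] by metis+
        then show "x + y \<in> I" by (auto simp: I_def)
      next
        fix r x assume "x \<in> I"
        then obtain z where "z \<in> span B" "s x b + z \<in> N" by (auto simp: I_def)
        moreover have "s (r * x) b + s r z = s r (s x b + z)"
          by (simp add: scale_right_distrib)
        ultimately have "s (r * x) b + s r z \<in> N" "s r z \<in> span B"
          using subspace_scale[OF N(1)] span_scale[of z B r] by auto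
        then show "r * x \<in> I" by (auto simp: I_def)
      qed
      then obtain C where C: "finite C" "I = module.span (*) C"
        using noeth by (auto simp: noetherian_def fin_gen_def)
      then have "C \<subseteq> I" by (simp add: module.span_superset[OF module_mult])
      then obtain z where z: "\<And>c. c \<in> C \<Longrightarrow> z c \<in> span B \<and> s c b + z c \<in> N"
        unfolding I_def by (simp add: subset_iff Bex_def) metis
      obtain D where D: "finite D" "N \<inter> span B = span D"
        using insert.IH N(1) by (force simp: fin_gen_def intro!: subspace_inter)
      define G where "G = (\<lambda>c. s c b + z c) ` C"
      have "G \<subseteq> N" using z by (auto simp: G_def)
      then have GN: "span G \<subseteq> N" using N(1) by (rule span_minimal)
      \<comment> \<open>The generators lifted from \<open>C\<close> already realize every coefficient \<open>k\<close> in \<open>I\<close>.\<close>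
      have lift: "\<exists>w\<in>span B. s k b + w \<in> span G" if "k \<in> I" for k
      proof -
        have "k \<in> module.span (*) C" using that C(2) by simp
        then show ?thesis
        proof (induction rule: module.span_induct_alt[OF module_mult, consumes 1, case_names base step])
          case base
          then show ?case by (auto intro!: bexI[of _ 0] span_zero)
        next
          case (step c x y)
          then obtain w where "w \<in> span B" "s y b + w \<in> span G" by auto
          moreover have "s x b + z x \<in> span G" using step(1) by (auto simp: G_def intro!: span_base)
          moreover have "s (c * x + y) b + (s c (z x) + w) = s c (s x b + z x) + (s y b + w)"
            by (simp add: algebra_simps)
          moreover have "s c (z x) + w \<in> span B" using z[OF step(1)] \<open>w \<in> span B\<close>
            by (auto intro: span_add span_scale)
          ultimately show ?case by (metis span_add span_scale)
        qed
      qed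
      have "N = span (G \<union> D)"
      proof
        have "D \<subseteq> N" using D(2) span_superset[of D] by auto
        then show "span (G \<union> D) \<subseteq> N" using \<open>G \<subseteq> N\<close> N(1) by (intro span_minimal Un_least)
        show "N \<subseteq> span (G \<union> D)"
        proof
          fix x assume x: "x \<in> N"
          then obtain k where k: "x - s k b \<in> span B"
            using N(2) span_breakdown_eq[of x b B] by blast
          have "k \<in> I" unfolding I_def using x k by (auto intro!: bexI[of _ "x - s k b"])
          then obtain w where w: "w \<in> span B" "s k b + w \<in> span G" using lift by auto
          have "x - (s k b + w) \<in> N" using x w(2) GN N(1) by (auto intro: subspace_diff)
          moreover have "x - (s k b + w) \<in> span B"
            using span_diff[OF k w(1)] by (simp add: algebra_simps)
          ultimately have "x - (s k b + w) \<in> span D" using D(2) by auto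
          then have "x - (s k b + w) \<in> span (G \<union> D)" "s k b + w \<in> span (G \<union> D)"
            using w(2) span_mono[of G "G \<union> D"] span_mono[of D "G \<union> D"] by blast+
          then show "x \<in> span (G \<union> D)" using span_add_eq by (metis diff_add_cancel)
        qed
      qed
      moreover have "finite (G \<union> D)" using C(1) D(1) by (simp add: G_def)
      ultimately show "fin_gen s N" by (auto simp: fin_gen_def)
    qed
  qed
  then show ?thesis using assms(3,4) by (auto simp: fin_gen_def)
qed

section \<open>Radical ideals and minimal primes\<close>

text \<open>
  Noetherian induction. If \<open>a b \<in> I\<close> with \<open>a, b \<notin> I\<close>, then the primes found for \<open>I + (a)\<close> and for
  \<open>I + (b)\<close> serve together for \<open>I\<close>, since the product of these two ideals lies in \<open>I\<close>.
\<close>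

lemma radical_finite_primes:
  fixes I :: "'r::comm_ring_1 set"
  assumes noeth: "noetherian TYPE('r)" and "ring_ideal I"
  shows "\<exists>S. finite S \<and> (\<forall>Q\<in>S. ring_prime Q \<and> I \<subseteq> Q) \<and> (\<forall>x\<in>\<Inter>S. \<exists>n. x ^ n \<in> I)"
  using assms
proof (induction I rule: noetherian_induct)
  case (ideal I)
  note I = ideal(1) and IH = ideal(2)
  consider "I = UNIV" | "ring_prime I" | "I \<noteq> UNIV" "\<not> ring_prime I" by auto
  then show ?case
  proof cases
    case 1
    then show ?thesis by (intro exI[of _ "{}"]) auto
  next
    case 2
    then show ?thesis by (intro exI[of _ "{I}"]) (auto intro!: exI[of _ 1])
  next
    case 3
    then obtain a b where ab: "a * b \<in> I" "a \<notin> I" "b \<notin> I" using I by (auto simp: ring_prime_def)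
    define J where "J a = {x + r * a | x r. x \<in> I}" for a
    have J: "ring_ideal (J a) \<and> I \<subset> J a" if "a \<notin> I" for a
    proof (intro conjI psubsetI)
      show "ring_ideal (J a)"
      proof (rule ring_idealI)
        have "0 = 0 + 0 * a" by simp
        then show "0 \<in> J a" unfolding J_def using ring_ideal_zero[OF I] by blast
        fix x y assume "x \<in> J a" "y \<in> J a"
        then obtain x' r y' t where "x' \<in> I" "y' \<in> I" "x = x' + r * a" "y = y' + t * a"
          by (auto simp: J_def)
        then have "x + y = (x' + y') + (r + t) * a" "x' + y' \<in> I"
          using ring_ideal_add[OF I] by (auto simp: algebra_simps)
        then show "x + y \<in> J a" unfolding J_def by blast
      next
        fix t x assume "x \<in> J a"
        then obtain x' r where "x' \<in> I" "x = x' + r * a" by (auto simp: J_def)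
        then have "t * x = t * x' + (t * r) * a" "t * x' \<in> I"
          using ring_ideal_mult[OF I, of x' t] by (simp_all add: algebra_simps)
        then show "t * x \<in> J a" unfolding J_def by blast
      qed
      have "x = x + 0 * a" for x by simp
      then show "I \<subseteq> J a" unfolding J_def by blast
      have "a = 0 + 1 * a" by simp
      then have "a \<in> J a" unfolding J_def using ring_ideal_zero[OF I] by blast
      then show "I \<noteq> J a" using that by auto
    qed
    obtain S where S: "finite S" "\<forall>Q\<in>S. ring_prime Q \<and> J a \<subseteq> Q" "\<forall>x\<in>\<Inter>S. \<exists>n. x ^ n \<in> J a"
      using IH J[OF ab(2)] by metis
    obtain T where T: "finite T" "\<forall>Q\<in>T. ring_prime Q \<and> J b \<subseteq> Q" "\<forall>x\<in>\<Inter>T. \<exists>n. x ^ n \<in> J b"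
      using IH J[OF ab(3)] by metis
    have "\<exists>n. x ^ n \<in> I" if x: "x \<in> \<Inter>(S \<union> T)" for x
    proof -
      have "x \<in> \<Inter>S" "x \<in> \<Inter>T" using x by auto
      then obtain n m where "x ^ n \<in> J a" "x ^ m \<in> J b" using S(3) T(3) by meson
      then obtain y r z t where yz: "y \<in> I" "z \<in> I" "x ^ n = y + r * a" "x ^ m = z + t * b"
        by (auto simp: J_def)
      have "x ^ (n + m) = (z + t * b) * y + (r * a) * z + (r * t) * (a * b)"
        by (simp add: power_add yz algebra_simps)
      also have "\<dots> \<in> I"
        by (intro ring_ideal_add[OF I] ring_ideal_mult[OF I, of y] ring_ideal_mult[OF I, of z]
            ring_ideal_mult[OF I, of "a * b"] yz ab(1))
      finally show ?thesis by blast
    qed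
    moreover have "\<forall>Q\<in>S \<union> T. ring_prime Q \<and> I \<subseteq> Q"
      using S(2) T(2) J[OF ab(2)] J[OF ab(3)] by (meson Un_iff psubset_imp_subset subset_trans)
    ultimately show ?thesis using S(1) T(1) by (intro exI[of _ "S \<union> T"]) blast
  qed
qed

text \<open>
  The minimal elements \<open>S\<close> of the finite set of primes above are the minimal primes over \<open>I\<close>. The
  last property expresses that the quotient by \<open>I\<close> localizes at \<open>P \<in> S\<close> to a field: the whole of
  \<open>P\<close> is killed modulo \<open>I\<close> by one element \<open>v\<close> outside \<open>P\<close>, a product of elements of the other primes.
  The later arguments at a minimal prime use this \<open>v\<close> instead of a localization.
\<close>

lemma radical_ideal_irredundant:
  fixes I :: "'r::comm_ring_1 set"
  assumes noeth: "noetherian TYPE('r)" and I: "ring_ideal I"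
    and rad: "\<And>x n. x ^ n \<in> I \<Longrightarrow> x \<in> I"
  obtains S where "finite S" "\<And>Q. Q \<in> S \<Longrightarrow> ring_prime Q" "I = \<Inter>S"
    and "\<And>P Q. ring_prime P \<Longrightarrow> I \<subseteq> P \<Longrightarrow> Q \<in> S \<Longrightarrow> P \<subseteq> Q \<Longrightarrow> P = Q"
    and "\<And>P. ring_prime P \<Longrightarrow> I \<subseteq> P \<Longrightarrow> \<exists>Q\<in>S. Q \<subseteq> P"
    and "\<And>P. P \<in> S \<Longrightarrow> \<exists>v. v \<notin> P \<and> (\<forall>a\<in>P. v * a \<in> I)"
proof -
  obtain T where T: "finite T" "\<forall>Q\<in>T. ring_prime Q \<and> I \<subseteq> Q" "\<forall>x\<in>\<Inter>T. \<exists>n. x ^ n \<in> I"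
    using radical_finite_primes[OF noeth I] by blast
  have IT: "I = \<Inter>T" using T(2,3) rad by blast
  have above: "\<exists>Q\<in>T. Q \<subseteq> P" if P: "ring_prime P" "I \<subseteq> P" for P
  proof (rule ccontr)
    assume "\<not> ?thesis"
    then have "\<forall>Q\<in>T. \<exists>x. x \<in> Q \<and> x \<notin> P" by blast
    then obtain x where x: "\<And>Q. Q \<in> T \<Longrightarrow> x Q \<in> Q \<and> x Q \<notin> P" by metis
    have "prod x T \<in> Q" if "Q \<in> T" for Q
      using x[OF that] T that
      by (simp add: prod.remove[OF T(1) that] ring_ideal_mult_right[OF ring_prime_ideal])
    then have "prod x T \<in> P" using IT P(2) by auto
    moreover have "prod x T \<notin> P" using x by (intro ring_prime_prod[OF P(1) T(1)]) auto
    ultimately show False by blast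
  qed
  define S where "S = {Q \<in> T. \<forall>Q'\<in>T. Q' \<subseteq> Q \<longrightarrow> Q' = Q}"
  have below: "\<exists>Q'\<in>S. Q' \<subseteq> Q" if Q: "Q \<in> T" for Q
  proof -
    obtain m where m: "m \<in> T" "m \<subseteq> Q" "\<And>b. b \<in> T \<Longrightarrow> b \<subseteq> m \<Longrightarrow> m = b"
      using finite_has_minimal2[OF T(1) Q] by auto
    then have "m \<in> S" unfolding S_def by blast
    then show ?thesis using m(2) by blast
  qed
  have S: "S \<subseteq> T" "finite S" using T(1) by (auto simp: S_def)
  have IS: "I = \<Inter>S" using IT below S(1) by blast
  have v: "\<exists>v. v \<notin> P \<and> (\<forall>a\<in>P. v * a \<in> I)" if P: "P \<in> S" for P
  proof -
    have "\<forall>Q\<in>S - {P}. \<exists>x. x \<in> Q \<and> x \<notin> P" using P by (auto simp: S_def)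
    then obtain x where x: "\<And>Q. Q \<in> S - {P} \<Longrightarrow> x Q \<in> Q \<and> x Q \<notin> P" by metis
    have prP: "ring_prime P" using P S T by auto
    have "prod x (S - {P}) * a \<in> Q" if "a \<in> P" "Q \<in> S" for a Q
    proof (cases "Q = P")
      case True
      then show ?thesis using that ring_ideal_mult[OF ring_prime_ideal[OF prP]] by auto
    next
      case False
      then have Q: "Q \<in> S - {P}" using that by auto
      have "ring_ideal Q" using \<open>Q \<in> S\<close> S T by (auto intro: ring_prime_ideal)
      then show ?thesis using x[OF Q] S(2) Q
        by (auto simp: prod.remove[OF _ Q] intro!: ring_ideal_mult_right)
    qed
    moreover have "prod x (S - {P}) \<notin> P" using x S(2) by (intro ring_prime_prod[OF prP]) auto
    ultimately show ?thesis using IS by blast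
  qed
  show ?thesis
  proof (rule that[of S])
    show "P = Q" if P: "ring_prime P" "I \<subseteq> P" and Q: "Q \<in> S" "P \<subseteq> Q" for P Q
    proof -
      obtain Q' where Q': "Q' \<in> T" "Q' \<subseteq> P" using above[OF P] by auto
      moreover have "Q' \<subseteq> Q" using Q'(2) Q(2) by simp
      ultimately have "Q' = Q" using Q(1) unfolding S_def by simp
      then show ?thesis using Q'(2) Q(2) by simp
    qed
    show "\<exists>Q\<in>S. Q \<subseteq> P" if P: "ring_prime P" "I \<subseteq> P" for P
    proof -
      obtain Q where "Q \<in> T" "Q \<subseteq> P" using above[OF P] by auto
      then show ?thesis using below[of Q] by auto
    qed
  qed (use S T IS v in auto)
qed

lemma
  assumes "noetherian TYPE('r::comm_ring_1)" "reduced TYPE('r)"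
  shows finite_minimal_primes: "finite {P :: 'r set. minimal_prime P}"
    and Inter_minimal_primes: "\<Inter>{P :: 'r set. minimal_prime P} = {0}"
    and prime_contains_minimal_prime:
      "ring_prime (P :: 'r set) \<Longrightarrow> \<exists>Q. minimal_prime Q \<and> Q \<subseteq> P"
    and minimal_prime_annihilated:
      "minimal_prime (P :: 'r set) \<Longrightarrow> \<exists>v. v \<notin> P \<and> (\<forall>a\<in>P. v * a = 0)"
proof -
  have I: "ring_ideal {0 :: 'r}" by (auto simp: ring_ideal_iff)
  have rad: "x \<in> {0}" if "x ^ n \<in> {0}" for x :: 'r and n
    using assms(2) that by (auto simp: reduced_def)
  obtain S where S: "finite S" "\<And>Q. Q \<in> S \<Longrightarrow> ring_prime Q" "{0 :: 'r} = \<Inter>S"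
    "\<And>P Q. ring_prime P \<Longrightarrow> {0} \<subseteq> P \<Longrightarrow> Q \<in> S \<Longrightarrow> P \<subseteq> Q \<Longrightarrow> P = Q"
    "\<And>P. ring_prime P \<Longrightarrow> {0} \<subseteq> P \<Longrightarrow> \<exists>Q\<in>S. Q \<subseteq> P"
    "\<And>P. P \<in> S \<Longrightarrow> \<exists>v. v \<notin> P \<and> (\<forall>a\<in>P. v * a \<in> {0})"
    by (rule radical_ideal_irredundant[OF assms(1) I rad]) (assumption, rule that, assumption+)
  have zero: "{0} \<subseteq> P" if "ring_prime P" for P :: "'r set"
    using ring_ideal_zero[OF ring_prime_ideal[OF that]] by auto
  have "minimal_prime P \<longleftrightarrow> P \<in> S" for P
    unfolding minimal_prime_def using S(2,4,5) zero by metis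
  then have eq: "{P. minimal_prime P} = S" by auto
  show "finite {P :: 'r set. minimal_prime P}" "\<Inter>{P :: 'r set. minimal_prime P} = {0}"
    using S(1,3) eq by auto
  show "\<exists>Q. minimal_prime Q \<and> Q \<subseteq> P" if "ring_prime P"
    using S(5)[OF that zero[OF that]] eq by blast
  show "\<exists>v. v \<notin> P \<and> (\<forall>a\<in>P. v * a = 0)" if "minimal_prime P"
    using S(6) eq that by auto
qed

lemma minimal_prime_prime: "minimal_prime P \<Longrightarrow> ring_prime P"
  by (simp add: minimal_prime_def)

text \<open>
  Prime avoidance for the minimal primes of a reduced ring.
\<close>

lemma ideal_meets_ring_circ:
  fixes I :: "'r::comm_ring_1 set"
  assumes "noetherian TYPE('r)" "reduced TYPE('r)" and I: "ring_ideal I"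
    and notin: "\<And>P. minimal_prime P \<Longrightarrow> \<not> I \<subseteq> P"
  obtains c where "c \<in> I" "c \<in> ring_circ"
proof -
  let ?S = "{P :: 'r set. minimal_prime P}"
  have "\<forall>P::'r set. \<exists>v. minimal_prime P \<longrightarrow> v \<notin> P \<and> (\<forall>a\<in>P. v * a = 0)"
    using minimal_prime_annihilated[OF assms(1,2)] by blast
  from choice[OF this] obtain v :: "'r set \<Rightarrow> 'r"
    where "\<forall>P. minimal_prime P \<longrightarrow> v P \<notin> P \<and> (\<forall>a\<in>P. v P * a = 0)" ..
  then have v: "\<And>P. minimal_prime P \<Longrightarrow> v P \<notin> P \<and> (\<forall>a\<in>P. v P * a = 0)" by blast
  have "\<forall>P. \<exists>a. minimal_prime P \<longrightarrow> a \<in> I \<and> a \<notin> P" using notin by blast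
  from choice[OF this] obtain a :: "'r set \<Rightarrow> 'r" where "\<forall>P. minimal_prime P \<longrightarrow> a P \<in> I \<and> a P \<notin> P" ..
  then have a: "\<And>P. minimal_prime P \<Longrightarrow> a P \<in> I \<and> a P \<notin> P" by blast
  \<comment> \<open>\<open>v P\<close> lies in every minimal prime but \<open>P\<close>, so modulo \<open>Q\<close> only the summand for \<open>Q\<close> survives.\<close>
  have v_in: "v P \<in> Q" if PQ: "minimal_prime P" "minimal_prime Q" "P \<noteq> Q" for P Q
  proof -
    obtain x where x: "x \<in> P" "x \<notin> Q" using PQ by (metis minimal_prime_def subsetI)
    then have "v P * x = 0" using v PQ by auto
    then have "v P * x \<in> Q"
      using ring_ideal_zero[OF ring_prime_ideal[OF minimal_prime_prime[OF PQ(2)]]] by simp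
    then show ?thesis using ring_prime_mult[OF minimal_prime_prime[OF PQ(2)]] x by auto
  qed
  define c where "c = (\<Sum>P\<in>?S. v P * a P)"
  have "c \<in> I" unfolding c_def using a by (auto intro!: ring_ideal_sum[OF I] ring_ideal_mult[OF I])
  moreover have "c \<notin> Q" if Q: "minimal_prime Q" for Q
  proof
    assume "c \<in> Q"
    have Q': "ring_prime Q" "ring_ideal Q" using Q ring_prime_ideal minimal_prime_prime by auto
    have "c = v Q * a Q + (\<Sum>P\<in>?S - {Q}. v P * a P)"
      unfolding c_def using Q finite_minimal_primes[OF assms(1,2)] by (subst sum.remove[of _ Q]) auto
    moreover have "(\<Sum>P\<in>?S - {Q}. v P * a P) \<in> Q"
      using v_in Q by (auto intro!: ring_ideal_sum[OF Q'(2)] ring_ideal_mult_right[OF Q'(2)])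
    ultimately have "v Q * a Q \<in> Q" using \<open>c \<in> Q\<close> ring_ideal_diff[OF Q'(2)]
      by (metis add_diff_cancel_right')
    then show False using ring_prime_mult[OF Q'(1)] v[OF Q] a[OF Q] by auto
  qed
  ultimately show ?thesis using that by (auto simp: ring_circ_def)
qed

lemma ring_circ_mult: "c \<in> ring_circ \<Longrightarrow> d \<in> ring_circ \<Longrightarrow> c * d \<in> ring_circ"
  unfolding ring_circ_def using ring_prime_mult minimal_prime_prime by blast

lemma ring_circ_power: "c \<in> ring_circ \<Longrightarrow> c ^ n \<in> ring_circ"
  unfolding ring_circ_def using ring_prime_power minimal_prime_prime by blast

lemma ring_circ_one: "1 \<in> ring_circ"
  unfolding ring_circ_def using ring_prime_one minimal_prime_prime by blast

lemma ring_circ_cancel: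
  fixes c :: "'r::comm_ring_1"
  assumes "noetherian TYPE('r)" "reduced TYPE('r)" and "c \<in> ring_circ" "c * x = 0"
  shows "x = 0"
proof -
  have "x \<in> P" if P: "minimal_prime P" for P
  proof -
    have "c * x \<in> P" using assms(4) P ring_ideal_zero ring_prime_ideal minimal_prime_prime by metis
    then show ?thesis
      using assms(3) P ring_prime_mult[OF minimal_prime_prime[OF P]] by (auto simp: ring_circ_def)
  qed
  then show ?thesis using Inter_minimal_primes[OF assms(1,2)] by blast
qed

section \<open>Generic projectivity\<close>

text \<open>
  If a finitely generated module agrees with its submodule \<open>N\<close> after localization at \<open>P\<close>, then the
  product of the denominators for the generators works for all elements.
\<close>

lemma common_multiplier:
  fixes t :: "'r::comm_ring_1 \<Rightarrow> 'm::ab_group_add \<Rightarrow> 'm"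
  assumes "module t" and G: "finite G" "module.span t G = UNIV"
    and P: "ring_prime P" and N: "module.subspace t N"
    and "\<And>g. g \<in> G \<Longrightarrow> \<exists>u. u \<notin> P \<and> t u g \<in> N"
  obtains u where "u \<notin> P" "\<And>x. t u x \<in> N"
proof -
  interpret module t by fact
  obtain u where u: "\<And>g. g \<in> G \<Longrightarrow> u g \<notin> P \<and> t (u g) g \<in> N" using assms(6) by metis
  have "t (prod u G) g \<in> N" if "g \<in> G" for g
  proof -
    have "prod u G = prod u (G - {g}) * u g"
      by (simp add: prod.remove[OF G(1) that] mult.commute)
    then have "t (prod u G) g = t (prod u (G - {g})) (t (u g) g)" by simp
    then show ?thesis using u[OF that] subspace_scale[OF N] by metis
  qed
  then have "G \<subseteq> {x. t (prod u G) x \<in> N}" by auto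
  moreover have "subspace {x. t (prod u G) x \<in> N}"
    using N
    by (intro subspaceI)
       (auto simp: scale_right_distrib subspace_0 subspace_add scale_left_commute[of "prod u G"]
          subspace_scale simp del: scale_scale)
  ultimately have "t (prod u G) x \<in> N" for x using span_minimal[of G] G(2) by blast
  moreover have "prod u G \<notin> P" using u by (intro ring_prime_prod[OF P G(1)]) auto
  ultimately show ?thesis using that by blast
qed

text \<open>
  At a prime \<open>P\<close> killed by some \<open>v \<notin> P\<close>, the localized module is a vector space, and a basis of it
  can be picked from the generators \<open>G\<close>. The maps \<open>\<phi> b\<close> are the coordinate functions with their
  denominators cleared, and \<open>\<phi> b = 0\<close> for the generators outside the basis.
\<close>

lemma local_dual_basis:
  fixes t :: "'r::comm_ring_1 \<Rightarrow> 'm::ab_group_add \<Rightarrow> 'm"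
  assumes "module t" and G: "finite G" "module.span t G = UNIV"
    and P: "ring_prime P" and v: "v \<notin> P" "\<And>a. a \<in> P \<Longrightarrow> v * a = 0"
  shows "\<exists>c \<phi>. c \<notin> P \<and> (\<forall>b. module_hom t (*) (\<phi> b)) \<and> (\<forall>x. t c x = (\<Sum>b\<in>G. t (\<phi> b x) b))"
proof -
  interpret module t by fact
  note P' = ring_prime_ideal[OF P]
  define indep where "indep B \<longleftrightarrow> (\<forall>a. (\<Sum>b\<in>B. t (a b) b) = 0 \<longrightarrow> (\<forall>b\<in>B. a b \<in> P))" for B
  have "finite {B. B \<subseteq> G \<and> indep B}" using G(1) by simp
  moreover have "{} \<in> {B. B \<subseteq> G \<and> indep B}" by (simp add: indep_def)
  ultimately have "\<exists>B\<in>{B. B \<subseteq> G \<and> indep B}. \<forall>B'\<in>{B. B \<subseteq> G \<and> indep B}. B \<subseteq> B' \<longrightarrow> B = B'"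
    by (intro finite_has_maximal) auto
  then obtain B where B: "B \<subseteq> G" "indep B"
    and "\<forall>B'\<in>{B. B \<subseteq> G \<and> indep B}. B \<subseteq> B' \<longrightarrow> B = B'" by (elim bexE CollectE conjE)
  then have maxB: "\<And>B'. B' \<subseteq> G \<Longrightarrow> indep B' \<Longrightarrow> B \<subseteq> B' \<Longrightarrow> B = B'" by simp
  have finB: "finite B" using B(1) G(1) by (rule finite_subset)
  have "\<exists>u. u \<notin> P \<and> t u g \<in> span B" if g: "g \<in> G" for g
  proof (cases "g \<in> B")
    case True
    then show ?thesis using ring_prime_one[OF P] by (intro exI[of _ 1]) (auto intro: span_base)
  next
    case False
    then have "\<not> indep (insert g B)" using maxB[of "insert g B"] g B(1) by auto
    then obtain a where a: "t (a g) g + (\<Sum>b\<in>B. t (a b) b) = 0" "\<exists>b\<in>insert g B. a b \<notin> P"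
      using False finB by (auto simp: indep_def)
    \<comment> \<open>Otherwise multiplication by \<open>v\<close> turns the relation into one among the elements of \<open>B\<close>.\<close>
    have "a g \<notin> P"
    proof
      assume ag: "a g \<in> P"
      have "t v (t (a g) g + (\<Sum>b\<in>B. t (a b) b)) = (\<Sum>b\<in>B. t (v * a b) b)"
        by (simp add: scale_right_distrib scale_sum_right v(2)[OF ag])
      then have "(\<Sum>b\<in>B. t (v * a b) b) = 0" using a(1) by simp
      then have "\<forall>b\<in>B. v * a b \<in> P"
        using B(2)[unfolded indep_def, rule_format, of "\<lambda>b. v * a b"] by simp
      then have "\<forall>b\<in>B. a b \<in> P" using v(1) ring_prime_mult[OF P] by blast
      then show False using a(2) ag by auto
    qed
    moreover have "t (a g) g = - (\<Sum>b\<in>B. t (a b) b)" using a(1) by (simp add: eq_neg_iff_add_eq_0)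
    then have "t (a g) g \<in> span B" by (simp only:) (intro span_neg span_sum span_scale span_base)
    ultimately show ?thesis by blast
  qed
  then obtain U where U: "U \<notin> P" "\<And>x. t U x \<in> span B"
    using common_multiplier[OF \<open>module t\<close> G P subspace_span] by blast
  have "\<exists>a. t U x = (\<Sum>b\<in>B. t (a b) b)" for x
    using U(2)[of x] span_finite[OF finB] by (metis (no_types, lifting) imageE)
  then obtain a where a: "\<And>x. t U x = (\<Sum>b\<in>B. t (a x b) b)" by metis
  \<comment> \<open>The coordinates are determined only modulo \<open>P\<close>; multiplying by \<open>v\<close> removes the ambiguity.\<close>
  define \<phi> where "\<phi> b x = (if b \<in> B then v * a x b else 0)" for b x
  have zero: "v * d b = 0" if "(\<Sum>b\<in>B. t (d b) b) = 0" "b \<in> B" for d b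
    using that B(2)[unfolded indep_def, rule_format, of d] v(2) by simp
  have "module_hom t (*) (\<phi> b)" for b
  proof -
    have "\<phi> b (x + y) = \<phi> b x + \<phi> b y" for x y
    proof (cases "b \<in> B")
      case True
      have "(\<Sum>b\<in>B. t (a (x + y) b - a x b - a y b) b) = t U (x + y) - t U x - t U y"
        by (simp only: a scale_left_diff_distrib sum_subtractf)
      also have "\<dots> = 0" by (simp add: scale_right_distrib)
      finally have "v * (a (x + y) b - a x b - a y b) = 0" by (rule zero) fact
      then show ?thesis using True by (simp add: \<phi>_def algebra_simps)
    qed (simp add: \<phi>_def)
    moreover have "\<phi> b (t r x) = r * \<phi> b x" for r x
    proof (cases "b \<in> B")
      case True
      have "(\<Sum>b\<in>B. t (a (t r x) b - r * a x b) b) = t U (t r x) - t r (t U x)"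
        by (simp only: a scale_left_diff_distrib sum_subtractf) (simp only: scale_sum_right scale_scale)
      also have "\<dots> = 0" by (simp add: mult.commute)
      finally have "v * (a (t r x) b - r * a x b) = 0" by (rule zero) fact
      then show ?thesis using True by (simp add: \<phi>_def algebra_simps)
    qed (simp add: \<phi>_def)
    ultimately show ?thesis using \<open>module t\<close> module_mult by (simp add: module_hom_iff)
  qed
  moreover have "t (v * U) x = (\<Sum>b\<in>G. t (\<phi> b x) b)" for x
  proof -
    have "t (v * U) x = t v (t U x)" by simp
    also have "\<dots> = (\<Sum>b\<in>B. t (\<phi> b x) b)" by (simp only: a) (simp add: \<phi>_def scale_sum_right)
    also have "\<dots> = (\<Sum>b\<in>G. t (\<phi> b x) b)"
      by (rule sum.mono_neutral_left) (use G B in \<open>auto simp: \<phi>_def\<close>)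
    finally show ?thesis .
  qed
  moreover have "v * U \<notin> P" using v U by (intro ring_prime_mult_notin[OF P])
  ultimately show ?thesis by blast
qed

text \<open>
  Multiplication by some \<open>c\<close> in \<open>R\<^sup>\<circ>\<close> factors through a finite free module, that is, the module is
  projective up to the denominator \<open>c\<close>. Its ranks at the various minimal primes may differ. The
  elements \<open>c\<close> with this property form an ideal, because the generating set \<open>G\<close> is the same for all
  of them, and by \<open>local_dual_basis\<close> no minimal prime contains this ideal.
\<close>

lemma generic_dual_basis:
  fixes t :: "'r::comm_ring_1 \<Rightarrow> 'm::ab_group_add \<Rightarrow> 'm"
  assumes noeth: "noetherian TYPE('r)" and red: "reduced TYPE('r)"
    and "module t" and "fin_gen t UNIV"
  obtains c G \<phi> where "c \<in> ring_circ" "finite G" "\<And>b. module_hom t (*) (\<phi> b)"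
    and "\<And>x. t c x = (\<Sum>b\<in>G. t (\<phi> b x) b)"
proof -
  interpret module t by fact
  interpret module_pair t "(*)" by (intro module_pair.intro \<open>module t\<close> module_mult)
  obtain G where G: "finite G" "span G = UNIV" using assms(4) by (auto simp: fin_gen_def)
  define I where
    "I = {c. \<exists>\<phi>. (\<forall>b. module_hom t (*) (\<phi> b)) \<and> (\<forall>x. t c x = (\<Sum>b\<in>G. t (\<phi> b x) b))}"
  have "ring_ideal I"
  proof (rule ring_idealI)
    show "0 \<in> I"
      unfolding I_def by (auto intro!: exI[of _ "\<lambda>b x. 0"] module_hom_zero)
    fix c d assume "c \<in> I" "d \<in> I"
    then obtain \<phi> \<psi> where "\<forall>b. module_hom t (*) (\<phi> b)" "\<forall>b. module_hom t (*) (\<psi> b)"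
      "\<forall>x. t c x = (\<Sum>b\<in>G. t (\<phi> b x) b)" "\<forall>x. t d x = (\<Sum>b\<in>G. t (\<psi> b x) b)"
      by (auto simp: I_def)
    then show "c + d \<in> I"
      unfolding I_def
      by (auto intro!: exI[of _ "\<lambda>b x. \<phi> b x + \<psi> b x"] module_hom_add
          simp: scale_left_distrib sum.distrib)
  next
    fix r c assume "c \<in> I"
    then obtain \<phi> where "\<forall>b. module_hom t (*) (\<phi> b)" "\<forall>x. t c x = (\<Sum>b\<in>G. t (\<phi> b x) b)"
      by (auto simp: I_def)
    then show "r * c \<in> I"
      unfolding I_def
      by (auto intro!: exI[of _ "\<lambda>b x. r * \<phi> b x"] module_hom_scale
          simp: scale_sum_right simp flip: scale_scale)
  qed
  moreover have "\<not> I \<subseteq> P" if P: "minimal_prime P" for P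
  proof -
    obtain v where "v \<notin> P" "\<And>a. a \<in> P \<Longrightarrow> v * a = 0"
      using minimal_prime_annihilated[OF noeth red P] by auto
    from local_dual_basis[OF \<open>module t\<close> G minimal_prime_prime[OF P] this]
    show ?thesis by (auto simp: I_def)
  qed
  ultimately obtain c where "c \<in> I" "c \<in> ring_circ"
    using ideal_meets_ring_circ[OF noeth red] by blast
  then show ?thesis using G(1) that[of c G] by (auto simp: I_def)
qed

section \<open>Strong test elements\<close>

text \<open>
  Nakayama's lemma for the module \<open>J\<close> and the ideal \<open>J\<close>, with \<open>c\<close> in the role of a unit. The
  generators are removed one by one: if \<open>w = c\<^sup>k - a\<close> maps \<open>J\<close> into the span of \<open>g\<close> and \<open>H\<close>, then
  \<open>w c g \<in> J g + span H\<close>, which gives a multiple of \<open>w\<close> that maps \<open>J\<close> into the span of \<open>H\<close> and is again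
  a power of \<open>c\<close> minus an element of \<open>J\<close>.
\<close>

lemma nakayama_power:
  fixes J :: "'r::comm_ring_1 set"
  assumes "fin_gen (*) J"
    and square: "\<And>x. x \<in> J \<Longrightarrow> c * x \<in> module.span (*) {a * b |a b. a \<in> J \<and> b \<in> J}"
  obtains a k where "a \<in> J" "\<And>x. x \<in> J \<Longrightarrow> (c ^ k - a) * x = 0"
proof -
  let ?span = "module.span ((*) :: 'r \<Rightarrow> 'r \<Rightarrow> 'r)"
  note sp = module.span_add[OF module_mult] module.span_scale[OF module_mult]
    module.span_zero[OF module_mult] module.span_diff[OF module_mult]
  note breakdown = module.span_breakdown_eq[OF module_mult]
  obtain G where G: "finite G" "J = ?span G" using assms(1) by (auto simp: fin_gen_def)
  have J: "ring_ideal J" using G(2) module.subspace_span[OF module_mult] by simp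
  have "\<exists>a\<in>J. \<exists>k. \<forall>x\<in>J. (c ^ k - a) * x \<in> ?span (G - D)" if "finite D" "D \<subseteq> G" for D
    using that
  proof (induction D rule: finite_induct)
    case empty
    show ?case using G(2) ring_ideal_zero[OF J] by (intro bexI[of _ 0] exI[of _ 0]) auto
  next
    case (insert g D)
    then obtain a k where a: "a \<in> J" "\<And>x. x \<in> J \<Longrightarrow> (c ^ k - a) * x \<in> ?span (G - D)" by auto
    define w where "w = c ^ k - a"
    define H where "H = G - insert g D"
    have "G - D = insert g H" using insert by (auto simp: H_def)
    then have w: "\<And>x. x \<in> J \<Longrightarrow> \<exists>r. w * x - r * g \<in> ?span H"
      using a(2) by (simp add: w_def breakdown)
    have "g \<in> J" using insert G(2) module.span_base[OF module_mult] by auto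
    define T where "T = {x. \<exists>j\<in>J. w * x - j * g \<in> ?span H}"
    have "ring_ideal T"
    proof (rule ring_idealI)
      show "0 \<in> T" using ring_ideal_zero[OF J] sp(3) by (auto simp: T_def intro!: bexI[of _ 0])
      fix x y assume "x \<in> T" "y \<in> T"
      then obtain i j where ij: "i \<in> J" "j \<in> J" "w * x - i * g \<in> ?span H" "w * y - j * g \<in> ?span H"
        by (auto simp: T_def)
      have "w * (x + y) - (i + j) * g = (w * x - i * g) + (w * y - j * g)"
        by (simp add: algebra_simps)
      then have "w * (x + y) - (i + j) * g \<in> ?span H" using sp(1)[OF ij(3,4)] by simp
      then show "x + y \<in> T" using ring_ideal_add[OF J ij(1,2)] by (auto simp: T_def)
    next
      fix r x assume "x \<in> T"
      then obtain j where j: "j \<in> J" "w * x - j * g \<in> ?span H" by (auto simp: T_def)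
      have "w * (r * x) - (r * j) * g = r * (w * x - j * g)" by (simp add: algebra_simps)
      then have "w * (r * x) - (r * j) * g \<in> ?span H" using sp(2)[OF j(2)] by simp
      then show "r * x \<in> T" using ring_ideal_mult[OF J j(1)] by (auto simp: T_def)
    qed
    moreover have "x * y \<in> T" if xy: "x \<in> J" "y \<in> J" for x y
    proof -
      obtain r where r: "w * y - r * g \<in> ?span H" using w[OF xy(2)] by auto
      have "w * (x * y) - (r * x) * g = x * (w * y - r * g)" by (simp add: algebra_simps)
      then have "w * (x * y) - (r * x) * g \<in> ?span H" using sp(2)[OF r] by simp
      then show ?thesis using ring_ideal_mult[OF J xy(1)] by (auto simp: T_def)
    qed
    ultimately have "?span {a * b |a b. a \<in> J \<and> b \<in> J} \<subseteq> T"
      by (intro module.span_minimal[OF module_mult]) auto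
    then have "c * g \<in> T" using square[OF \<open>g \<in> J\<close>] by auto
    then obtain j where j: "j \<in> J" "w * (c * g) - j * g \<in> ?span H" by (auto simp: T_def)
    \<comment> \<open>Chosen so that \<open>(w c - j) w = c\<^sup>2\<^sup>k\<^sup>+\<^sup>1 - a'\<close>.\<close>
    define a' where "a' = c ^ Suc k * a + c ^ k * (a * c + j) - a * (a * c + j)"
    have "a * c + j \<in> J" using a(1) j(1) J ring_ideal_mult_right ring_ideal_add by blast
    then have "a' \<in> J" unfolding a'_def
      using a(1) J ring_ideal_mult ring_ideal_add ring_ideal_diff by meson
    moreover have "(c ^ Suc (2 * k) - a') * x \<in> ?span H" if x: "x \<in> J" for x
    proof -
      obtain r where r: "w * x - r * g \<in> ?span H" using w[OF x] by auto
      have pw: "c ^ Suc (2 * k) = c * c ^ k * c ^ k" by (simp add: mult_2 power_add mult.assoc)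
      have "(c ^ Suc (2 * k) - a') * x
          = (w * c - j) * (w * x - r * g) + r * (w * (c * g) - j * g)"
        unfolding a'_def w_def pw by (simp add: algebra_simps)
      then show ?thesis using sp(1)[OF sp(2)[OF r] sp(2)[OF j(2)]] by simp
    qed
    ultimately show ?case unfolding H_def by blast
  qed
  from this[OF G(1) order_refl] obtain a k where "a \<in> J" "\<forall>x\<in>J. (c ^ k - a) * x \<in> ?span {}"
    by auto
  then show ?thesis using that by (auto simp: module.span_empty[OF module_mult])
qed

subsection \<open>Frobenius twists\<close>

lemma frob_twist_0: "frob_twist 0 s = s"
  by (simp add: frob_twist_def fun_eq_iff)

lemma power_CHAR_power_add:
  "(x + y :: 'r::comm_ring_prime_char) ^ (CHAR('r) ^ e) = x ^ (CHAR('r) ^ e) + y ^ (CHAR('r) ^ e)"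
  by (rule freshmans_dream') auto

lemma module_frob_twist:
  fixes s :: "'r::comm_ring_prime_char \<Rightarrow> 'm::ab_group_add \<Rightarrow> 'm"
  assumes "module s"
  shows "module (frob_twist e s)"
proof -
  interpret module s by fact
  show ?thesis
    by unfold_locales
       (simp_all add: frob_twist_def scale_right_distrib power_CHAR_power_add scale_left_distrib
          power_mult_distrib)
qed

lemma frob_hom_iff:
  fixes s :: "'r::comm_ring_prime_char \<Rightarrow> 'm::ab_group_add \<Rightarrow> 'm"
  assumes "module s" "module t"
  shows "module_hom (frob_twist e s) t g \<longleftrightarrow>
    (\<forall>x y. g (x + y) = g x + g y) \<and> (\<forall>r x. g (s (r ^ (CHAR('r) ^ e)) x) = t r (g x))"
  using module_frob_twist[OF assms(1)] assms(2) by (simp add: module_hom_iff frob_twist_def)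

lemma frob_hom_scale:
  fixes s :: "'r::comm_ring_prime_char \<Rightarrow> 'm::ab_group_add \<Rightarrow> 'm"
  assumes "module s" "module t" "module_hom (frob_twist e s) t g"
  shows "module_hom (frob_twist e s) t (\<lambda>x. t r (g x))"
  using assms(3) by (intro module_pair.module_hom_scale module_pair.intro module_frob_twist assms(1,2))

text \<open>
  Composition of Cartier maps adds the degrees. For \<open>f = 0\<close> or \<open>e = 0\<close> this is composition with an
  \<open>R\<close>-linear map.
\<close>

lemma frob_hom_compose:
  fixes s :: "'r::comm_ring_prime_char \<Rightarrow> 'm::ab_group_add \<Rightarrow> 'm"
  assumes "module s" "module t" "module u"
    and "module_hom (frob_twist e s) t g" "module_hom (frob_twist f t) u h"
  shows "module_hom (frob_twist (e + f) s) u (\<lambda>x. h (g x))"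
proof -
  have "g (s (r ^ (CHAR('r) ^ (e + f))) x) = t (r ^ (CHAR('r) ^ f)) (g x)" for r x
  proof -
    have "r ^ (CHAR('r) ^ (e + f)) = (r ^ (CHAR('r) ^ f)) ^ (CHAR('r) ^ e)"
      by (simp add: power_add mult.commute flip: power_mult)
    then show ?thesis using assms(4) by (simp add: frob_hom_iff[OF assms(1,2)])
  qed
  then show ?thesis
    using assms(4,5)
    by (simp add: frob_hom_iff[OF assms(1,2)] frob_hom_iff[OF assms(2,3)] frob_hom_iff[OF assms(1,3)])
qed

subsection \<open>Cartier images\<close>

text \<open>
  The image of the evaluation map from \<open>Hom(\<^sup>eR, R)\<close> to \<open>R\<close> at \<open>\<^sup>ed\<close>.
\<close>

definition cartier_image :: "nat \<Rightarrow> 'r::comm_ring_1 \<Rightarrow> 'r set" where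
  "cartier_image e d = {\<phi> d |\<phi>. module_hom (frob_twist e (*)) (*) \<phi>}"

lemma cartier_imageI: "module_hom (frob_twist e (*)) (*) \<phi> \<Longrightarrow> \<phi> d \<in> cartier_image e d"
  by (auto simp: cartier_image_def)

lemma cartier_imageE:
  assumes "y \<in> cartier_image e d"
  obtains \<phi> where "module_hom (frob_twist e (*)) (*) \<phi>" "\<phi> d = y"
  using assms by (auto simp: cartier_image_def)

lemma ring_ideal_cartier_image: "ring_ideal (cartier_image e (d :: 'r::comm_ring_prime_char))"
proof (rule ring_idealI)
  interpret module_pair "frob_twist e ((*) :: 'r \<Rightarrow> 'r \<Rightarrow> 'r)" "(*)"
    by (intro module_pair.intro module_frob_twist module_mult)
  show "0 \<in> cartier_image e d" by (rule cartier_imageI[OF module_hom_zero])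
  show "x + y \<in> cartier_image e d" if "x \<in> cartier_image e d" "y \<in> cartier_image e d" for x y
    using that by (elim cartier_imageE) (use cartier_imageI[OF module_hom_add] in force)
  show "r * x \<in> cartier_image e d" if "x \<in> cartier_image e d" for r x
    using that by (elim cartier_imageE) (use cartier_imageI[OF module_hom_scale] in force)
qed

lemma cartier_image_compose:
  fixes d :: "'r::comm_ring_prime_char"
  assumes "y \<in> cartier_image e d" and \<psi>: "module_hom (frob_twist f (*)) (*) \<psi>"
  shows "\<psi> y \<in> cartier_image (e + f) d"
proof -
  obtain \<phi> where \<phi>: "module_hom (frob_twist e (*)) (*) \<phi>" "\<phi> d = y"
    using assms(1) by (rule cartier_imageE)
  show ?thesis
    using cartier_imageI[OF frob_hom_compose[OF module_mult module_mult module_mult \<phi>(1) \<psi>], of d]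
    by (simp only: \<phi>(2))
qed

lemma CHAR_ge_2: "2 \<le> CHAR('r::comm_ring_prime_char)"
  by (rule prime_ge_2_nat[OF CHAR_prime])

text \<open>
  The dual basis of \<open>\<^sup>1R\<close> expands \<open>c\<^sup>p y\<close> as \<open>\<Sum> \<phi>\<^sub>b(y)\<^sup>p b\<close>. If \<open>y\<close> is a value at \<open>d\<close> of a map of degree
  \<open>e\<close>, then each \<open>\<phi>\<^sub>b(y)\<close> is one of a map of degree \<open>e + 1\<close>, and its \<open>p\<close>-th power lies in
  the square of the ideal of these values because \<open>p \<ge> 2\<close>.
\<close>

lemma dual_basis_cartier_image:
  fixes d :: "'r::comm_ring_prime_char"
  assumes \<phi>: "\<And>b. module_hom (frob_twist 1 (*)) (*) (\<phi> b)"
    and dual: "\<And>x. frob_twist 1 (*) c x = (\<Sum>b\<in>G. frob_twist 1 (*) (\<phi> b x) b)"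
    and y: "y \<in> cartier_image e d"
  shows "c ^ CHAR('r) * y \<in>
    module.span (*) {a * b |a b. a \<in> cartier_image (Suc e) d \<and> b \<in> cartier_image (Suc e) d}"
proof -
  let ?I = "cartier_image (Suc e) d"
  obtain k where k: "CHAR('r) = Suc (Suc k)"
    using CHAR_ge_2[where 'r = 'r] by (metis add_2_eq_Suc le_Suc_ex)
  have "c ^ CHAR('r) * y = (\<Sum>b\<in>G. \<phi> b y ^ CHAR('r) * b)"
    using dual[of y] by (simp add: frob_twist_def)
  also have "\<dots> = (\<Sum>b\<in>G. (b * \<phi> b y ^ k) * (\<phi> b y * \<phi> b y))"
    unfolding k by (intro sum.cong) (simp_all add: algebra_simps)
  also have "\<dots> \<in> module.span (*) {a * b |a b. a \<in> ?I \<and> b \<in> ?I}"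
  proof (rule module.span_sum[OF module_mult], rule module.span_scale[OF module_mult],
      rule module.span_base[OF module_mult])
    fix b
    have "\<phi> b y \<in> ?I" using cartier_image_compose[OF y \<phi>, of b] by simp
    then show "\<phi> b y * \<phi> b y \<in> {a * b |a b. a \<in> ?I \<and> b \<in> ?I}" by blast
  qed
  finally show ?thesis .
qed

text \<open>
  With \<open>c\<close> the \<open>p\<close>-th power of the denominator of \<open>\<^sup>1R\<close>, \<open>dual_basis_cartier_image\<close> says
  \<open>c I\<^sub>e \<subseteq> I\<^sub>e\<^sub>+\<^sub>1\<^sup>2\<close> for \<open>I\<^sub>e = cartier_image e d\<close>. The saturations \<open>J\<^sub>e = (I\<^sub>e : c\<^sup>\<infinity>)\<close> form an ascending
  chain; its stable value \<open>J\<close> satisfies \<open>c\<^sup>N\<^sup>+\<^sup>1 J \<subseteq> J\<^sup>2\<close> for some \<open>N\<close>, so \<open>c\<^sup>m - a\<close> kills \<open>J\<close> for some \<open>m\<close>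
  and \<open>a \<in> J\<close>. As \<open>J\<close> contains the nonzerodivisor \<open>d\<close>, this forces \<open>c\<^sup>m = a \<in> J\<close>.
\<close>

lemma test_element_power:
  assumes noeth: "noetherian TYPE('r::comm_ring_prime_char)"
    and red: "reduced TYPE('r::comm_ring_prime_char)"
    and "F_finite TYPE('r::comm_ring_prime_char)"
  obtains c :: "'r::comm_ring_prime_char" where "c \<in> ring_circ"
    and "\<And>d. d \<in> ring_circ \<Longrightarrow> \<exists>e\<ge>1. \<exists>n. c ^ n \<in> cartier_image e d"
proof -
  obtain c0 :: 'r and G \<phi> where c0: "c0 \<in> ring_circ" "finite G"
    "\<And>b. module_hom (frob_twist 1 (*)) (*) (\<phi> b)"
    "\<And>x. frob_twist 1 (*) c0 x = (\<Sum>b\<in>G. frob_twist 1 (*) (\<phi> b x) b)"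
    by (rule generic_dual_basis[OF noeth red module_frob_twist[OF module_mult]
          assms(3)[unfolded F_finite_def]]) (rule that; assumption)
  define c where "c = c0 ^ CHAR('r)"
  show ?thesis
  proof (rule that[of c])
    show "c \<in> ring_circ" unfolding c_def by (rule ring_circ_power) fact
    fix d :: 'r assume d: "d \<in> ring_circ"
    have step: "c * y \<in> module.span (*)
        {a * b |a b. a \<in> cartier_image (Suc e) d \<and> b \<in> cartier_image (Suc e) d}"
      if "y \<in> cartier_image e d" for y e
      unfolding c_def by (rule dual_basis_cartier_image[OF c0(3,4) that])
    have step': "c * y \<in> cartier_image (Suc e) d" if "y \<in> cartier_image e d" for y e
    proof -
      have "module.span (*) {a * b |a b. a \<in> cartier_image (Suc e) d \<and> b \<in> cartier_image (Suc e) d}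
          \<subseteq> cartier_image (Suc e) d"
        by (intro module.span_minimal[OF module_mult _ ring_ideal_cartier_image])
           (auto intro: ring_ideal_mult[OF ring_ideal_cartier_image])
      then show ?thesis using step[OF that] by blast
    qed
    define J where "J e = {r. \<exists>n. c ^ n * r \<in> cartier_image e d}" for e
    have raise: "c ^ (k + n) * r \<in> cartier_image e d" if "c ^ n * r \<in> cartier_image e d" for k n r e
      using ring_ideal_mult[OF ring_ideal_cartier_image that, of "c ^ k"]
      by (simp add: power_add mult.assoc)
    have J: "ring_ideal (J e)" for e
    proof (rule ring_idealI)
      show "0 \<in> J e" using ring_ideal_zero[OF ring_ideal_cartier_image] by (simp add: J_def)
      fix x y assume "x \<in> J e" "y \<in> J e"
      then obtain m n where "c ^ m * x \<in> cartier_image e d" "c ^ n * y \<in> cartier_image e d"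
        by (auto simp: J_def)
      then have "c ^ (n + m) * x + c ^ (m + n) * y \<in> cartier_image e d"
        using raise ring_ideal_add[OF ring_ideal_cartier_image] by blast
      then show "x + y \<in> J e" unfolding J_def by (auto simp: distrib_left add.commute intro: exI[of _ "m + n"])
    next
      fix r x assume "x \<in> J e"
      then obtain n where "c ^ n * x \<in> cartier_image e d" by (auto simp: J_def)
      then have "c ^ n * (r * x) \<in> cartier_image e d"
        using ring_ideal_mult[OF ring_ideal_cartier_image, of "c ^ n * x" e d r] by (simp add: mult_ac)
      then show "r * x \<in> J e" by (auto simp: J_def)
    qed
    have asc: "J e \<subseteq> J (Suc e)" for e
    proof
      fix x assume "x \<in> J e"
      then obtain n where "c ^ n * x \<in> cartier_image e d" by (auto simp: J_def)
      from step'[OF this] have "c ^ Suc n * x \<in> cartier_image (Suc e) d" by (simp add: mult.assoc)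
      then show "x \<in> J (Suc e)" unfolding J_def by blast
    qed
    obtain e where e: "\<And>n. e \<le> n \<Longrightarrow> J n = J e"
      using noetherian_chain_stabilizes[of J, OF noeth J asc] by blast
    have "fin_gen (*) (J e)" using noeth J by (auto simp: noetherian_def)
    then obtain B where B: "finite B" "J e = module.span (*) B" by (auto simp: fin_gen_def)
    then have "B \<subseteq> J e" using module.span_superset[OF module_mult] by simp
    then have "\<forall>b\<in>B. \<exists>n. c ^ n * b \<in> cartier_image e d"
      unfolding J_def by blast
    then obtain n where n: "\<And>b. b \<in> B \<Longrightarrow> c ^ n b * b \<in> cartier_image e d" by metis
    define N where "N = Max (insert 0 (n ` B))"
    have "B \<subseteq> {x. c ^ N * x \<in> cartier_image e d}"
    proof
      fix b assume b: "b \<in> B"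
      then have "N = (N - n b) + n b" using B(1) by (simp add: N_def)
      then show "b \<in> {x. c ^ N * x \<in> cartier_image e d}" using raise[OF n[OF b]] by (metis mem_Collect_eq)
    qed
    moreover have "{x. c ^ N * x \<in> cartier_image e d} = colon (*) (cartier_image e d) {c ^ N}"
      by (simp add: colon_def mult.commute)
    then have "ring_ideal {x. c ^ N * x \<in> cartier_image e d}"
      using ring_ideal_colon[OF module_mult ring_ideal_cartier_image] by metis
    ultimately have "module.span (*) B \<subseteq> {x. c ^ N * x \<in> cartier_image e d}"
      by (rule module.span_minimal[OF module_mult])
    then have N: "c ^ N * x \<in> cartier_image e d" if "x \<in> J e" for x
      using B(2) that by auto
    have "cartier_image (Suc e) d \<subseteq> J (Suc e)" unfolding J_def by (auto intro: exI[of _ 0])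
    then have sub: "cartier_image (Suc e) d \<subseteq> J e" using e[of "Suc e"] by simp
    have "c ^ Suc N * x \<in> module.span (*) {a * b |a b. a \<in> J e \<and> b \<in> J e}" if "x \<in> J e" for x
    proof -
      have "c ^ Suc N * x = c * (c ^ N * x)" by (simp add: mult.assoc)
      also have "\<dots> \<in> module.span (*)
          {a * b |a b. a \<in> cartier_image (Suc e) d \<and> b \<in> cartier_image (Suc e) d}"
        by (rule step[OF N[OF that]])
      also have "\<dots> \<subseteq> module.span (*) {a * b |a b. a \<in> J e \<and> b \<in> J e}"
        by (rule module.span_mono[OF module_mult]) (use sub in blast)
      finally show ?thesis .
    qed
    from nakayama_power[OF \<open>fin_gen (*) (J e)\<close> this]
    obtain a k where a: "a \<in> J e" "\<And>x. x \<in> J e \<Longrightarrow> ((c ^ Suc N) ^ k - a) * x = 0" by blast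
    have "d \<in> cartier_image 0 d"
      unfolding cartier_image_def frob_twist_0
      using module_pair.module_hom_scale module.module_hom_ident[OF module_mult] by fast
    then have "d \<in> J 0" unfolding J_def by (auto intro: exI[of _ 0])
    moreover have "J 0 \<subseteq> J e" using lift_Suc_mono_le[of J 0 e] asc by simp
    ultimately have "d * ((c ^ Suc N) ^ k - a) = 0" using a(2)[of d] by (auto simp: mult.commute)
    then have "(c ^ Suc N) ^ k - a = 0" by (rule ring_circ_cancel[OF noeth red d])
    then have "(c ^ Suc N) ^ k = a" by (rule iffD1[OF right_minus_eq])
    then have "c ^ (Suc N * k) \<in> J (Suc e)" using a(1) e[of "Suc e"] by (simp only: power_mult)
    then obtain m where "c ^ m * c ^ (Suc N * k) \<in> cartier_image (Suc e) d"
      unfolding J_def by blast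
    then have "c ^ (m + Suc N * k) \<in> cartier_image (Suc e) d" by (simp only: power_add)
    then show "\<exists>e\<ge>1. \<exists>n. c ^ n \<in> cartier_image e d" by (intro exI[of _ "Suc e"]) auto
  qed
qed

text \<open>
  The exponent in \<open>test_element_power\<close> depends on \<open>d\<close>; the argument of Hochster and Huneke removes
  this dependence. For \<open>d = 1\<close> it yields \<open>\<psi> : \<^sup>1R \<rightarrow> R\<close> with value \<open>c\<close> at 1, where \<open>c\<close> is a power of the
  element found there. Then \<open>c\<^sup>2\<close> is a value at 1 in every degree \<open>f\<close>, because
  \<open>\<psi>(c\<^sup>p\<^sup>-\<^sup>2 c\<^sup>2) = c \<psi>(1) = c\<^sup>2\<close>. Now let a power \<open>c1\<^sup>m\<close> of the original
  element be a value at \<open>d\<close> in degree \<open>e\<close>, and let \<open>p\<^sup>f \<ge> m\<close>. Then \<open>c\<close> to the power \<open>p\<^sup>f\<close>, a multiple of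
  \<open>c1\<^sup>m\<close>, is also a value at \<open>d\<close>, and a map of degree \<open>f\<close> with value \<open>c\<^sup>2\<close> at 1 sends it to \<open>c\<^sup>3\<close>, which
  no longer depends on \<open>m\<close>. The map of degree 1 with value \<open>c\<^sup>3\<close> at 1 serves later to
  produce operators in \<open>C\<^sup>+\<close>.
\<close>

lemma test_element:
  assumes noeth: "noetherian TYPE('r::comm_ring_prime_char)"
    and red: "reduced TYPE('r::comm_ring_prime_char)"
    and "F_finite TYPE('r::comm_ring_prime_char)"
  obtains c :: "'r::comm_ring_prime_char" where "c \<in> ring_circ"
    and "\<And>d e0. d \<in> ring_circ \<Longrightarrow> \<exists>e\<ge>e0. c \<in> cartier_image e d"
    and "\<exists>\<psi>. module_hom (frob_twist 1 (*)) (*) \<psi> \<and> \<psi> 1 = c"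
proof -
  let ?p = "CHAR('r)"
  note hom_iff = frob_hom_iff[OF module_mult module_mult]
  obtain c1 :: 'r where c1: "c1 \<in> ring_circ"
    "\<And>d. d \<in> ring_circ \<Longrightarrow> \<exists>e\<ge>1. \<exists>n. c1 ^ n \<in> cartier_image e d"
    using test_element_power[OF assms] by blast
  obtain e n where "1 \<le> e" "c1 ^ n \<in> cartier_image e 1" using c1(2)[OF ring_circ_one] by auto
  \<comment> \<open>The exponent is raised by one so that it is positive and powers of \<open>c\<close> dominate powers of \<open>c1\<close>.\<close>
  then have en: "c1 ^ Suc n \<in> cartier_image (Suc (e - 1)) 1"
    using ring_ideal_mult[OF ring_ideal_cartier_image, of "c1 ^ n" e 1 c1] by simp
  define c where "c = c1 ^ Suc n"
  obtain \<phi> where \<phi>: "module_hom (frob_twist (Suc (e - 1)) (*)) (*) \<phi>" "\<phi> 1 = c"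
    using en unfolding cartier_image_def c_def by auto
  \<comment> \<open>Precomposing with an iterated Frobenius \<open>\<^sup>1R \<rightarrow> \<^sup>eR\<close> lowers the degree of \<open>\<phi>\<close> to 1.\<close>
  define \<psi> where "\<psi> x = \<phi> (x ^ ?p ^ (e - 1))" for x
  have \<psi>: "module_hom (frob_twist 1 (*)) (*) \<psi>"
    using \<phi>(1) unfolding hom_iff \<psi>_def
    by (simp add: power_CHAR_power_add power_mult_distrib flip: power_mult)
  have \<psi>1: "\<psi> 1 = c" using \<phi>(2) by (simp add: \<psi>_def)
  have sq: "c ^ 2 \<in> cartier_image f 1" for f
  proof (induction f)
    case 0
    have "module_hom (*) (*) (\<lambda>x. c ^ 2 * x)"
      by (rule module.module_hom_scale_self[OF module_mult])
    then show ?case unfolding cartier_image_def frob_twist_0 by (auto intro!: exI[of _ "\<lambda>x. c ^ 2 * x"])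
  next
    case (Suc f)
    have "\<psi> (c ^ (?p - 2) * c ^ 2) \<in> cartier_image (f + 1) 1"
      by (rule cartier_image_compose[OF ring_ideal_mult[OF ring_ideal_cartier_image Suc] \<psi>])
    moreover have "c ^ (?p - 2) * c ^ 2 = c ^ ?p"
      using CHAR_ge_2[where 'r = 'r] by (metis le_add_diff_inverse2 power_add)
    moreover have "\<psi> (c ^ ?p * 1) = c * \<psi> 1" using \<psi> unfolding hom_iff by (metis power_one_right)
    ultimately show ?case by (simp add: \<psi>1 power2_eq_square)
  qed
  show ?thesis
  proof (rule that[of "c ^ 3"])
    show "c ^ 3 \<in> ring_circ" unfolding c_def by (intro ring_circ_power c1)
    have "module_hom (frob_twist 1 (*)) (*) (\<lambda>x. c ^ 2 * \<psi> x)"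
      by (rule frob_hom_scale[OF module_mult module_mult \<psi>])
    then show "\<exists>\<psi>. module_hom (frob_twist 1 (*)) (*) \<psi> \<and> \<psi> 1 = c ^ 3"
      by (rule exI[of _ "\<lambda>x. c ^ 2 * \<psi> x", OF conjI]) (simp add: \<psi>1 power2_eq_square power3_eq_cube)
    fix d :: 'r and e0 assume d: "d \<in> ring_circ"
    obtain e m where m: "c1 ^ m \<in> cartier_image e d" using c1(2)[OF d] by auto
    \<comment> \<open>The summand \<open>m\<close> gives \<open>m \<le> p\<^sup>f\<close>, the summand \<open>e0\<close> makes the total degree large.\<close>
    define f where "f = m + e0"
    have "f < ?p ^ f" using CHAR_ge_2[where 'r = 'r] by (intro power_gt_expt) auto
    then have "m \<le> ?p ^ f" by (simp add: f_def)
    then have "m \<le> Suc n * ?p ^ f" by simp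
    then have "c1 ^ (Suc n * ?p ^ f) = c1 ^ (Suc n * ?p ^ f - m) * c1 ^ m"
      by (metis le_add_diff_inverse2 power_add)
    then have "c ^ (?p ^ f) = c1 ^ (Suc n * ?p ^ f - m) * c1 ^ m"
      by (simp only: c_def power_mult)
    then have "c ^ (?p ^ f) \<in> cartier_image e d"
      using ring_ideal_mult[OF ring_ideal_cartier_image m] by simp
    moreover obtain \<chi> where \<chi>: "module_hom (frob_twist f (*)) (*) \<chi>" "\<chi> 1 = c ^ 2"
      using sq[of f] unfolding cartier_image_def by auto
    ultimately have "\<chi> (c ^ (?p ^ f) * 1) \<in> cartier_image (e + f) d"
      using cartier_image_compose by fastforce
    moreover have "\<chi> (c ^ (?p ^ f) * 1) = c ^ 3"
      using \<chi>(2) \<chi>(1)[unfolded hom_iff, THEN conjunct2, rule_format, of c 1]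
      by (simp add: power2_eq_square power3_eq_cube)
    ultimately show "\<exists>e\<ge>e0. c ^ 3 \<in> cartier_image e d" by (intro exI[of _ "e + f"]) (simp add: f_def)
  qed
qed

section \<open>Stabilization of the Cartier chain\<close>

text \<open>
  Modulo \<open>B\<close> and after localization at \<open>P\<close>, the ambient module is a finite-dimensional vector space
  over the residue field, so a descending chain of submodules stabilizes. The induction removes one
  generator \<open>g\<close> at a time. Either every \<open>A n\<close> has elements whose \<open>g\<close>-coefficient is invertible at \<open>P\<close>,
  and these elements serve to clear the \<open>g\<close>-coefficients of the others; or from some point on all
  \<open>g\<close>-coefficients lie in \<open>P\<close>, and multiplication by \<open>v\<close> removes them. The multiplier \<open>u\<close> depends on
  \<open>m\<close>, but not on \<open>x\<close>.
\<close>

lemma descending_chain_generically_stable: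
  fixes s :: "'r::comm_ring_1 \<Rightarrow> 'm::ab_group_add \<Rightarrow> 'm"
  assumes "module s" and P: "ring_prime P" and v: "v \<notin> P" and B: "module.subspace s B"
    and "finite G"
    and "\<And>a x. a \<in> P \<Longrightarrow> x \<in> module.span s (B \<union> G) \<Longrightarrow> s (v * a) x \<in> B"
    and "\<And>n. module.subspace s (A n)" "\<And>n. A (Suc n) \<subseteq> A n" "\<And>n. B \<subseteq> A n"
    and "\<And>n. A n \<subseteq> module.span s (B \<union> G)"
  shows "\<exists>n. \<forall>m\<ge>n. \<exists>u. u \<notin> P \<and> (\<forall>x\<in>A n. s u x \<in> A m)"
  using assms(5-)
proof (induction G arbitrary: A rule: finite_induct)
  interpret module s by fact
  case empty
  have "A n = B" for n using empty(4,5)[of n] B by (auto simp: span_eq_iff[THEN iffD2])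
  then show ?case using ring_prime_one[OF P] by (intro exI[of _ 0] allI impI exI[of _ 1]) auto
next
  interpret module s by fact
  case (insert g G)
  let ?V = "span (B \<union> G)"
  have desc: "A m \<subseteq> A n" if "n \<le> m" for m n
    using lift_Suc_antimono_le[of A] insert.prems(3) that by blast
  have V: "?V \<subseteq> span (B \<union> insert g G)" by (intro span_mono) auto
  have gV: "\<exists>k. x - s k g \<in> ?V" if "x \<in> A n" for x n
  proof -
    have "x \<in> span (insert g (B \<union> G))" using insert.prems(5)[of n] that by auto
    then show ?thesis using span_breakdown_eq by blast
  qed
  have g: "g \<in> span (B \<union> insert g G)" by (auto intro: span_base)
  have "\<exists>n. \<forall>m\<ge>n. \<exists>u. u \<notin> P \<and> (\<forall>x\<in>A n \<inter> ?V. s u x \<in> A m \<inter> ?V)"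
  proof (rule insert.IH)
    show "s (v * a) x \<in> B" if "a \<in> P" "x \<in> ?V" for a x
      using insert.prems(1)[of a x] that V by auto
    show "subspace (A n \<inter> ?V)" for n using insert.prems(2) by (intro subspace_inter) auto
    show "A (Suc n) \<inter> ?V \<subseteq> A n \<inter> ?V" for n using insert.prems(3)[of n] by auto
    show "B \<subseteq> A n \<inter> ?V" for n using insert.prems(4)[of n] by (auto intro: span_base)
  qed auto
  then obtain n1 where n1: "\<And>m. n1 \<le> m \<Longrightarrow> \<exists>u. u \<notin> P \<and> (\<forall>x\<in>A n1 \<inter> ?V. s u x \<in> A m)"
    by blast
  show ?case
  proof (cases "\<forall>n. \<exists>w a. w \<notin> P \<and> a \<in> A n \<and> s w g - a \<in> ?V")
    case True
    show ?thesis
    proof (intro exI[of _ n1] allI impI)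
      fix m assume m: "n1 \<le> m"
      obtain u where u: "u \<notin> P" "\<And>x. x \<in> A n1 \<inter> ?V \<Longrightarrow> s u x \<in> A m" using n1[OF m] by auto
      obtain w a where w: "w \<notin> P" "a \<in> A m" "s w g - a \<in> ?V" using True by blast
      have "s (u * w) x \<in> A m" if x: "x \<in> A n1" for x
      proof -
        obtain k where k: "x - s k g \<in> ?V" using gV[OF x] by auto
        have "s w x - s k a \<in> A n1"
          using x w(2) desc[OF m] insert.prems(2)[of n1] by (auto intro: subspace_diff subspace_scale)
        moreover have "s w x - s k a = s w (x - s k g) + s k (s w g - a)"
          by (simp add: scale_right_diff_distrib mult.commute)
        then have "s w x - s k a \<in> ?V" using span_add[OF span_scale[OF k] span_scale[OF w(3)]] by simp
        ultimately have "s u (s w x - s k a) \<in> A m" by (intro u(2) IntI)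
        then have "s u (s w x - s k a) + s (u * k) a \<in> A m"
          by (intro subspace_add[OF insert.prems(2)] subspace_scale[OF insert.prems(2) w(2)])
        then show ?thesis by (simp add: scale_right_diff_distrib)
      qed
      then show "\<exists>u. u \<notin> P \<and> (\<forall>x\<in>A n1. s u x \<in> A m)"
        using ring_prime_mult_notin[OF P u(1) w(1)] by blast
    qed
  next
    case False
    then obtain n2 where n2: "\<And>w a. a \<in> A n2 \<Longrightarrow> s w g - a \<in> ?V \<Longrightarrow> w \<in> P" by blast
    show ?thesis
    proof (intro exI[of _ "max n1 n2"] allI impI)
      fix m assume m: "max n1 n2 \<le> m"
      obtain u where u: "u \<notin> P" "\<And>x. x \<in> A n1 \<inter> ?V \<Longrightarrow> s u x \<in> A m" using n1[of m] m by auto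
      have "s (u * v) x \<in> A m" if x: "x \<in> A (max n1 n2)" for x
      proof -
        have x12: "x \<in> A n1" "x \<in> A n2" using x desc[of n1 "max n1 n2"] desc[of n2 "max n1 n2"] by auto
        obtain k where k: "x - s k g \<in> ?V" using gV[OF x] by auto
        then have "s k g - x \<in> ?V" using span_neg by fastforce
        then have "k \<in> P" by (rule n2[OF x12(2)])
        then have "s (v * k) g \<in> ?V" using insert.prems(1)[OF _ g] span_base[of _ "B \<union> G"] by auto
        then have "s v (x - s k g) + s (v * k) g \<in> ?V" by (rule span_add[OF span_scale[OF k]])
        then have "s v x \<in> ?V" by (simp add: scale_right_diff_distrib)
        moreover have "s v x \<in> A n1" using x12(1) insert.prems(2) by (intro subspace_scale)
        ultimately have "s u (s v x) \<in> A m" by (intro u(2) IntI)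
        then show ?thesis by simp
      qed
      then show "\<exists>u. u \<notin> P \<and> (\<forall>x\<in>A (max n1 n2). s u x \<in> A m)"
        using ring_prime_mult_notin[OF P u(1) v] by blast
    qed
  qed
qed

abbreviation Cplus ::
  "('r::comm_ring_prime_char \<Rightarrow> 'm::ab_group_add \<Rightarrow> 'm) \<Rightarrow> 'm set \<Rightarrow> 'm set" where
  "Cplus s \<equiv> cartier_plus s (full_cartier s)"

lemma subspace_Cplus: "module s \<Longrightarrow> module.subspace s (Cplus s N)"
  by (simp add: cartier_plus_def module.subspace_span)

lemma Cplus_base:
  assumes "module s" "module_hom (frob_twist e s) s \<phi>" "1 \<le> e" "x \<in> N"
  shows "\<phi> x \<in> Cplus s N"
  unfolding cartier_plus_def using assms(2-)
  by (intro module.span_base[OF assms(1)]) (auto simp: full_cartier_def)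

lemma Cplus_least:
  assumes "module s" "module.subspace s T"
    and "\<And>e \<phi> x. 1 \<le> e \<Longrightarrow> module_hom (frob_twist e s) s \<phi> \<Longrightarrow> x \<in> N \<Longrightarrow> \<phi> x \<in> T"
  shows "Cplus s N \<subseteq> T"
  unfolding cartier_plus_def using assms(2-)
  by (intro module.span_minimal[OF assms(1)]) (auto simp: full_cartier_def)

lemma Cplus_mono: "module s \<Longrightarrow> N \<subseteq> N' \<Longrightarrow> Cplus s N \<subseteq> Cplus s N'"
  by (intro Cplus_least subspace_Cplus Cplus_base) auto

text \<open>
  This follows from \<open>a \<phi>(\<^sup>ex) = \<phi>(\<^sup>e(a\<^sup>q x))\<close> with \<open>q = p\<^sup>e \<ge> p\<close>; here the absence of degree 0 in \<open>C\<^sup>+\<close>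
  matters.
\<close>

lemma power_CHAR_mult_Cplus:
  fixes s :: "'r::comm_ring_prime_char \<Rightarrow> 'm::ab_group_add \<Rightarrow> 'm"
  assumes "module s" and N': "module.subspace s N'"
    and sub: "\<And>x. x \<in> N \<Longrightarrow> s (a ^ CHAR('r)) x \<in> N'" and "x \<in> Cplus s N"
  shows "s a x \<in> Cplus s N'"
proof -
  interpret module s by fact
  have "Cplus s N \<subseteq> {x. s a x \<in> Cplus s N'}"
  proof (rule Cplus_least[OF \<open>module s\<close>])
    show "subspace {x. s a x \<in> Cplus s N'}"
      using subspace_Cplus[OF \<open>module s\<close>, of N']
      by (intro subspaceI)
         (auto simp: scale_right_distrib subspace_0 subspace_add scale_left_commute[of a]
               intro: subspace_scale simp del: scale_scale)
    fix e \<phi> x assume e: "1 \<le> e" and \<phi>: "module_hom (frob_twist e s) s \<phi>" and x: "x \<in> N"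
    then obtain f where f: "e = Suc f" by (cases e) auto
    have "1 \<le> CHAR('r) ^ f" using CHAR_ge_2[where 'r = 'r] by (intro one_le_power) simp
    then have "CHAR('r) \<le> CHAR('r) ^ e" unfolding f by simp
    then have "a ^ (CHAR('r) ^ e) = a ^ (CHAR('r) ^ e - CHAR('r)) * a ^ CHAR('r)"
      by (metis le_add_diff_inverse2 power_add)
    then have "s (a ^ (CHAR('r) ^ e)) x = s (a ^ (CHAR('r) ^ e - CHAR('r))) (s (a ^ CHAR('r)) x)"
      by simp
    then have "s (a ^ (CHAR('r) ^ e)) x \<in> N'" using sub[OF x] subspace_scale[OF N'] by metis
    then have "\<phi> (s (a ^ (CHAR('r) ^ e)) x) \<in> Cplus s N'" by (rule Cplus_base[OF \<open>module s\<close> \<phi> e])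
    then show "\<phi> x \<in> {x. s a x \<in> Cplus s N'}"
      using \<phi> by (simp add: frob_hom_iff[OF \<open>module s\<close> \<open>module s\<close>])
  qed
  then show ?thesis using assms(4) by blast
qed

lemma radical_of_power_CHAR:
  fixes I :: "'r::comm_ring_prime_char set"
  assumes I: "ring_ideal I" and root: "\<And>x. x ^ CHAR('r) \<in> I \<Longrightarrow> x \<in> I" and "x ^ n \<in> I"
  shows "x \<in> I"
proof -
  have *: "x \<in> I" if "x ^ (CHAR('r) ^ k) \<in> I" for k
    using that
  proof (induction k)
    case (Suc k)
    then have "(x ^ (CHAR('r) ^ k)) ^ CHAR('r) \<in> I" by (simp add: mult.commute flip: power_mult)
    then show ?case using root Suc.IH by blast
  qed simp
  have "n < CHAR('r) ^ n" using CHAR_ge_2[where 'r = 'r] by (intro power_gt_expt) auto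
  then have "x ^ (CHAR('r) ^ n) = x ^ (CHAR('r) ^ n - n) * x ^ n"
    by (metis le_add_diff_inverse2 power_add less_imp_le)
  then show ?thesis using * ring_ideal_mult[OF I assms(3)] by metis
qed

text \<open>
  Let \<open>M\<^sub>n\<close> be the chain, \<open>I\<^sub>n = (M\<^sub>n\<^sub>+\<^sub>1 : M\<^sub>n)\<close>, \<open>B\<close> the intersection of all \<open>M\<^sub>n\<close>, and \<open>J\<^sub>n = (B : M\<^sub>n)\<close>. By
  \<open>power_CHAR_mult_Cplus\<close>, \<open>a\<^sup>p \<in> I\<^sub>n\<close> implies \<open>a \<in> I\<^sub>n\<^sub>+\<^sub>1\<close>, and likewise for \<open>J\<^sub>n\<close>; so both sequences
  ascend, and their stable values \<open>I\<close> and \<open>J\<close> are radical. For \<open>a \<in> I\<close> the square \<open>a\<^sup>2\<close> moves \<open>M\<^sub>n\<close> arbitrarily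
  deep into the chain, so \<open>I \<subseteq> J\<close>: for large \<open>n\<close> the quotient of \<open>M\<^sub>n\<close> by \<open>B\<close> is a module over \<open>R/I\<close>. If
  \<open>I\<close> is proper, pick a minimal prime \<open>P\<close> over it. There the chain stabilizes by
  \<open>descending_chain_generically_stable\<close>, so some \<open>I\<^sub>n = I\<close> contains an element outside \<open>P\<close>, which is absurd.
  Hence \<open>I = R\<close>.
\<close>

lemma Cplus_chain_stabilizes:
  fixes s :: "'r::comm_ring_prime_char \<Rightarrow> 'm::ab_group_add \<Rightarrow> 'm"
  assumes noeth: "noetherian TYPE('r)" and "module s" and fg: "fin_gen s UNIV"
  obtains n0 where "\<And>n. n0 \<le> n \<Longrightarrow> (Cplus s ^^ n) UNIV = (Cplus s ^^ n0) UNIV"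
proof -
  interpret module s by fact
  define M where "M n = (Cplus s ^^ n) UNIV" for n
  have M0: "M 0 = UNIV" and MSuc: "M (Suc n) = Cplus s (M n)" for n by (simp_all add: M_def)
  have subM: "subspace (M n)" for n
    by (cases n) (auto simp: M0 MSuc subspace_Cplus[OF \<open>module s\<close>])
  have dec: "M (Suc n) \<subseteq> M n" for n
  proof (induction n)
    case (Suc n)
    then show ?case using Cplus_mono[OF \<open>module s\<close>] by (simp add: MSuc)
  qed (simp add: M0)
  have desc: "M n \<subseteq> M m" if "m \<le> n" for m n
    using lift_Suc_antimono_le[of M] dec that by blast
  define I where "I n = colon s (M (Suc n)) (M n)" for n
  have I: "ring_ideal (I n)" for n unfolding I_def by (rule ring_ideal_colon[OF \<open>module s\<close> subM])
  have rootI: "a \<in> I (Suc n)" if a: "a ^ CHAR('r) \<in> I n" for a n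
    using power_CHAR_mult_Cplus[OF \<open>module s\<close> subM, of "M n" a "Suc n"] a
    by (simp add: I_def colon_def MSuc)
  have powI: "a ^ CHAR('r) \<in> K" if "a \<in> K" "ring_ideal K" for a and K :: "'r set"
    using ring_ideal_mult_right[OF that(2,1), of "a ^ (CHAR('r) - 1)"] power_minus_mult[of "CHAR('r)" a]
    by (simp add: mult.commute)
  have ascI: "I n \<subseteq> I (Suc n)" for n using rootI powI[OF _ I] by blast
  obtain n0 where n0: "\<And>n. n0 \<le> n \<Longrightarrow> I n = I n0"
    using noetherian_chain_stabilizes[of I, OF noeth I ascI] by blast
  have radI: "x \<in> I n0" if "x ^ n \<in> I n0" for x n
    using radical_of_power_CHAR[OF I _ that] rootI[of _ n0] n0[of "Suc n0"] by auto
  define B where "B = (\<Inter>n. M n)"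
  have subB: "subspace B" unfolding B_def using subM by (intro subspace_Int) auto
  have BM: "B \<subseteq> M n" for n by (auto simp: B_def)
  have CB: "Cplus s B \<subseteq> B"
  proof -
    have "Cplus s B \<subseteq> M n" for n
      using Cplus_mono[OF \<open>module s\<close> BM, of n] dec[of n] by (auto simp: MSuc)
    then show ?thesis by (auto simp: B_def)
  qed
  define J where "J n = colon s B (M n)" for n
  have J: "ring_ideal (J n)" for n unfolding J_def by (rule ring_ideal_colon[OF \<open>module s\<close> subB])
  have rootJ: "a \<in> J (Suc n)" if a: "a ^ CHAR('r) \<in> J n" for a n
    using power_CHAR_mult_Cplus[OF \<open>module s\<close> subB, of "M n" a] a CB
    by (auto simp: J_def colon_def MSuc)
  have ascJ: "J n \<subseteq> J (Suc n)" for n using rootJ powI[OF _ J] by blast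
  obtain n1 where n1: "\<And>n. n1 \<le> n \<Longrightarrow> J n = J n1"
    using noetherian_chain_stabilizes[of J, OF noeth J ascJ] by blast
  have radJ: "x \<in> J n1" if "x ^ n \<in> J n1" for x n
    using radical_of_power_CHAR[OF J _ that] rootJ[of _ n1] n1[of "Suc n1"] by auto
  have IJ: "I n0 \<subseteq> J n1"
  proof
    fix a assume a: "a \<in> I n0"
    have deep: "\<forall>n\<ge>n0. \<forall>x\<in>M n. s (a ^ 2) x \<in> M (n + k)" for k
    proof (induction k)
      case 0
      then show ?case using subspace_scale[OF subM] by simp
    next
      case (Suc k)
      show ?case
      proof (intro allI impI ballI)
        fix n x assume n: "n0 \<le> n" and x: "x \<in> M n"
        have ax: "s a x \<in> Cplus s (M n)"
          using a x n0[OF n] by (auto simp: I_def colon_def MSuc)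
        have "s a (s a x) \<in> Cplus s (M (n + k))"
        proof (rule power_CHAR_mult_Cplus[OF \<open>module s\<close> subM _ ax])
          fix y assume "y \<in> M n"
          then have "s (a ^ 2) y \<in> M (n + k)" using Suc n by blast
          moreover have "a ^ CHAR('r) = a ^ (CHAR('r) - 2) * a ^ 2"
            using CHAR_ge_2[where 'r = 'r] by (metis le_add_diff_inverse2 power_add)
          then have "s (a ^ CHAR('r)) y = s (a ^ (CHAR('r) - 2)) (s (a ^ 2) y)" by simp
          ultimately show "s (a ^ CHAR('r)) y \<in> M (n + k)" using subspace_scale[OF subM] by metis
        qed
        then show "s (a ^ 2) x \<in> M (n + Suc k)" by (simp add: MSuc power2_eq_square)
      qed
    qed
    have "s (a ^ 2) x \<in> M n" if x: "x \<in> M n0" for x n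
    proof -
      have "s (a ^ 2) x \<in> M (n0 + n)" using deep x by blast
      then show ?thesis using desc[of n "n0 + n"] by auto
    qed
    then have "a ^ 2 \<in> J n0" by (auto simp: J_def colon_def B_def)
    also have "J n0 \<subseteq> J (max n0 n1)" using lift_Suc_mono_le[of J] ascJ by (meson max.cobounded1)
    also have "J (max n0 n1) = J n1" by (rule n1) simp
    finally show "a \<in> J n1" by (rule radJ)
  qed
  have "I n0 = UNIV"
  proof (rule ccontr)
    assume neq: "I n0 \<noteq> UNIV"
    obtain S where S: "\<And>Q. Q \<in> S \<Longrightarrow> ring_prime Q" "I n0 = \<Inter>S"
      "\<And>P. P \<in> S \<Longrightarrow> \<exists>v. v \<notin> P \<and> (\<forall>a\<in>P. v * a \<in> I n0)"
      by (rule radical_ideal_irredundant[OF noeth I], erule radI) (rule that; assumption)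
    then obtain P where P: "P \<in> S" using neq by (metis Inf_empty ex_in_conv)
    then have prP: "ring_prime P" and IP: "I n0 \<subseteq> P" using S(1,2) by auto
    obtain v where v: "v \<notin> P" "\<And>a. a \<in> P \<Longrightarrow> v * a \<in> I n0" using S(3)[OF P] by blast
    define k where "k = max n0 n1"
    obtain G where G: "finite G" "M k = span G"
      using noetherian_submodule_fin_gen[OF noeth \<open>module s\<close> fg subM, of k] by (auto simp: fin_gen_def)
    have "span (B \<union> G) \<subseteq> M k"
      using BM[of k] G(2) subM span_superset[of G] by (intro span_minimal) auto
    moreover have "s (v * a) x \<in> B" if "a \<in> P" "x \<in> M k" for a x
    proof -
      have "x \<in> M n1" using that(2) desc[of n1 k] by (auto simp: k_def)
      then show ?thesis using v(2)[OF that(1)] IJ by (auto simp: J_def colon_def)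
    qed
    moreover have "M (k + n) \<subseteq> span (B \<union> G)" for n
      using desc[of k "k + n"] G(2) span_mono[of G "B \<union> G"] by auto
    ultimately have "\<exists>n. \<forall>m\<ge>n. \<exists>u. u \<notin> P \<and> (\<forall>x\<in>M (k + n). s u x \<in> M (k + m))"
      using dec subM BM
      by (intro descending_chain_generically_stable[OF \<open>module s\<close> prP v(1) subB G(1)]) auto
    then obtain n u where u: "u \<notin> P" "\<forall>x\<in>M (k + n). s u x \<in> M (k + Suc n)"
      by (meson le_SucI order_refl)
    then have "u \<in> I (k + n)" by (simp add: I_def colon_def)
    then show False using u(1) IP n0[of "k + n"] by (auto simp: k_def)
  qed
  then have const: "M (Suc n) = M n" if "n0 \<le> n" for n
    using n0[OF that] dec[of n] by (auto simp: I_def colon_def dest!: spec[of _ 1] eqset_imp_iff[of _ _ 1])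
  have "M n = M n0" if n: "n0 \<le> n" for n
    using n by (induction n rule: dec_induct) (auto simp: const)
  then show ?thesis using that unfolding M_def by blast
qed

lemma cartier_stable_eq:
  fixes s :: "'r::comm_ring_prime_char \<Rightarrow> 'm::ab_group_add \<Rightarrow> 'm"
  assumes "noetherian TYPE('r)" and "module s" and "fin_gen s UNIV"
  obtains n where "cartier_stable s (full_cartier s) = (Cplus s ^^ n) UNIV"
proof -
  obtain n0 where n0: "\<And>n. n0 \<le> n \<Longrightarrow> (Cplus s ^^ n) UNIV = (Cplus s ^^ n0) UNIV"
    using Cplus_chain_stabilizes[OF assms] by blast
  have "cartier_stable s (full_cartier s) = (Cplus s ^^ n0) UNIV"
    unfolding cartier_stable_def
  proof (rule the_equality)
    show "\<exists>m. \<forall>n\<ge>m. (Cplus s ^^ n) UNIV = (Cplus s ^^ n0) UNIV" using n0 by blast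
    fix N assume "\<exists>m. \<forall>n\<ge>m. (Cplus s ^^ n) UNIV = N"
    then obtain m where m: "\<And>n. m \<le> n \<Longrightarrow> (Cplus s ^^ n) UNIV = N" by blast
    then show "N = (Cplus s ^^ n0) UNIV" using n0[of "max m n0"] m[of "max m n0"] by simp
  qed
  then show ?thesis by (rule that)
qed

section \<open>Localization at a prime\<close>

lemma equiv_loc_rel:
  fixes s :: "'r::comm_ring_1 \<Rightarrow> 'm::ab_group_add \<Rightarrow> 'm"
  assumes "module s" and P: "ring_prime P"
  shows "equiv (UNIV \<times> (- P)) (loc_rel s P)"
proof (rule equivI)
  interpret module s by fact
  show "loc_rel s P \<subseteq> (UNIV \<times> - P) \<times> (UNIV \<times> - P)" by (auto simp: loc_rel_def)
  show "refl_on (UNIV \<times> - P) (loc_rel s P)"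
    using ring_prime_one[OF P] by (auto simp: refl_on_def loc_rel_def)
  show "sym (loc_rel s P)"
  proof (rule symI)
    fix z w assume "(z, w) \<in> loc_rel s P"
    then obtain x a y b u where "z = (x, a)" "w = (y, b)" "a \<notin> P" "b \<notin> P" "u \<notin> P"
      "s u (s b x - s a y) = 0" by (auto simp: loc_rel_def)
    moreover from this have "s u (s a y - s b x) = 0" by (simp add: scale_right_diff_distrib)
    ultimately show "(w, z) \<in> loc_rel s P" by (auto simp: loc_rel_def)
  qed
  show "trans (loc_rel s P)"
  proof (rule transI)
    fix p q r assume "(p, q) \<in> loc_rel s P" "(q, r) \<in> loc_rel s P"
    then obtain x a y b z c u w where pqr: "p = (x, a)" "q = (y, b)" "r = (z, c)"
      "a \<notin> P" "b \<notin> P" "c \<notin> P" "u \<notin> P" "w \<notin> P"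
      "s u (s b x - s a y) = 0" "s w (s c y - s b z) = 0"
      by (auto simp: loc_rel_def)
    have "s (u * w * b) (s c x - s a z)
        = s (w * c) (s u (s b x - s a y)) + s (u * a) (s w (s c y - s b z))"
      by (simp add: scale_right_diff_distrib mult_ac)
    also have "\<dots> = 0" by (simp only: pqr scale_zero_right add_0)
    finally have "s (u * w * b) (s c x - s a z) = 0" .
    moreover have "u * w * b \<notin> P" using pqr by (intro ring_prime_mult_notin[OF P])
    ultimately show "(p, r) \<in> loc_rel s P" using pqr by (auto simp: loc_rel_def)
  qed
qed

lemma loc_eq_UNIV_iff:
  fixes s :: "'r::comm_ring_1 \<Rightarrow> 'm::ab_group_add \<Rightarrow> 'm"
  assumes "module s" and P: "ring_prime P" and N: "module.subspace s N"
  shows "loc s P N = loc s P UNIV \<longleftrightarrow> (\<forall>x. \<exists>u. u \<notin> P \<and> s u x \<in> N)"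
proof
  interpret module s by fact
  note eqv = equiv_loc_rel[OF \<open>module s\<close> P]
  assume eq: "loc s P N = loc s P UNIV"
  show "\<forall>x. \<exists>u. u \<notin> P \<and> s u x \<in> N"
  proof
    fix x
    have "loc_rel s P `` {(x, 1)} \<in> loc s P UNIV"
      using ring_prime_one[OF P] by (auto simp: loc_def intro!: quotientI)
    then have "loc_rel s P `` {(x, 1)} \<in> loc s P N" by (simp only: eq)
    then obtain y a where ya: "y \<in> N" "a \<notin> P" "loc_rel s P `` {(x, 1)} = loc_rel s P `` {(y, a)}"
      by (auto simp: loc_def elim!: quotientE)
    have "((x, 1), (y, a)) \<in> loc_rel s P"
      using eq_equiv_class[OF ya(3) eqv] ya(2) by auto
    then obtain u where u: "u \<notin> P" "s u (s a x - s 1 y) = 0" by (auto simp: loc_rel_def)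
    then have "s (u * a) x = s u y" by (simp add: scale_right_diff_distrib)
    then have "s (u * a) x \<in> N" using subspace_scale[OF N ya(1)] by simp
    then show "\<exists>u. u \<notin> P \<and> s u x \<in> N" using ring_prime_mult_notin[OF P u(1) ya(2)] by blast
  qed
next
  interpret module s by fact
  note eqv = equiv_loc_rel[OF \<open>module s\<close> P]
  assume *: "\<forall>x. \<exists>u. u \<notin> P \<and> s u x \<in> N"
  show "loc s P N = loc s P UNIV"
  proof
    show "loc s P N \<subseteq> loc s P UNIV" by (auto simp: loc_def quotient_def)
    show "loc s P UNIV \<subseteq> loc s P N"
    proof
      fix X assume "X \<in> loc s P UNIV"
      then obtain x a where xa: "a \<notin> P" "X = loc_rel s P `` {(x, a)}"
        by (auto simp: loc_def elim!: quotientE)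
      obtain u where u: "u \<notin> P" "s u x \<in> N" using * by blast
      have "((x, a), (s u x, u * a)) \<in> loc_rel s P"
        using xa(1) u(1) ring_prime_mult_notin[OF P u(1) xa(1)] ring_prime_one[OF P]
        by (auto simp: loc_rel_def mult.commute intro!: exI[of _ 1])
      then have "X = loc_rel s P `` {(s u x, u * a)}"
        unfolding xa(2) by (rule equiv_class_eq[OF eqv])
      then show "X \<in> loc s P N"
        using u ring_prime_mult_notin[OF P u(1) xa(1)] by (auto simp: loc_def intro!: quotientI)
    qed
  qed
qed

lemma supp_witness:
  fixes s :: "'r::comm_ring_1 \<Rightarrow> 'm::ab_group_add \<Rightarrow> 'm"
  assumes "module s" "module_supp s = {P. ring_prime P}" "ring_prime P"
  obtains x where "\<And>u. u \<notin> P \<Longrightarrow> s u x \<noteq> 0"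
proof -
  have "P \<in> module_supp s" using assms(2,3) by simp
  then have "loc s P {0} \<noteq> loc s P UNIV" by (auto simp: module_supp_def)
  then show ?thesis
    using loc_eq_UNIV_iff[OF assms(1,3) module.subspace_single_0[OF assms(1)]] that by auto
qed

text \<open>
  If \<open>P\<close> is a minimal prime, \<open>x\<close> is nonzero in \<open>M\<^sub>P\<close>, and \<open>v \<notin> P\<close> kills \<open>P\<close>, then \<open>P\<close> is the annihilator of
  \<open>v x\<close>. So all minimal primes of \<open>R\<close> are associated, and every prime contains one of them.
\<close>

lemma min_assoc_primes_full_support:
  fixes s :: "'r::comm_ring_1 \<Rightarrow> 'm::ab_group_add \<Rightarrow> 'm"
  assumes "noetherian TYPE('r)" "reduced TYPE('r)"
    and "module s" and supp: "module_supp s = {P. ring_prime P}"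
  shows "min_assoc_primes s = {P. minimal_prime P}"
proof -
  interpret module s by fact
  have assoc: "P \<in> assoc_primes s" if P: "minimal_prime P" for P
  proof -
    note prP = minimal_prime_prime[OF P]
    obtain v where v: "v \<notin> P" "\<forall>a\<in>P. v * a = 0" using minimal_prime_annihilated[OF assms(1,2) P] by auto
    obtain x where x: "\<And>u. u \<notin> P \<Longrightarrow> s u x \<noteq> 0" using supp_witness[OF \<open>module s\<close> supp prP] by blast
    have "P = {r. s r (s v x) = 0}"
    proof
      show "P \<subseteq> {r. s r (s v x) = 0}" using v(2) by (auto simp: mult.commute)
      show "{r. s r (s v x) = 0} \<subseteq> P" using x ring_prime_mult_notin[OF prP _ v(1)] by auto
    qed
    then show ?thesis using prP unfolding assoc_primes_def by blast
  qed
  have prime: "ring_prime P" if "P \<in> assoc_primes s" for P using that by (simp add: assoc_primes_def)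
  show ?thesis
  proof (intro set_eqI iffI)
    fix P assume "P \<in> min_assoc_primes s"
    then have P: "P \<in> assoc_primes s" "\<forall>Q\<in>assoc_primes s. Q \<subseteq> P \<longrightarrow> Q = P"
      by (auto simp: min_assoc_primes_def)
    obtain Q where "minimal_prime Q" "Q \<subseteq> P" using prime_contains_minimal_prime[OF assms(1,2) prime[OF P(1)]] by auto
    then show "P \<in> {P. minimal_prime P}" using P(2) assoc by auto
  next
    fix P :: "'r set" assume "P \<in> {P. minimal_prime P}"
    then have P: "minimal_prime P" by simp
    have "Q = P" if "Q \<in> assoc_primes s" "Q \<subseteq> P" for Q
      using P prime[OF that(1)] that(2) unfolding minimal_prime_def by blast
    then show "P \<in> min_assoc_primes s" using assoc[OF P] by (simp add: min_assoc_primes_def)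
  qed
qed

text \<open>
  Finite generation gives one denominator outside each minimal prime, and prime avoidance combines
  these into a single element of \<open>R\<^sup>\<circ>\<close>. This turns generic equality into a statement about \<open>M\<close>
  itself.
\<close>

lemma generic_equality_iff_ring_circ:
  fixes s :: "'r::comm_ring_1 \<Rightarrow> 'm::ab_group_add \<Rightarrow> 'm"
  assumes "noetherian TYPE('r)" "reduced TYPE('r)"
    and "module s" "fin_gen s UNIV" and N: "module.subspace s N"
  shows "(\<forall>P. minimal_prime P \<longrightarrow> loc s P N = loc s P UNIV) \<longleftrightarrow> (\<exists>c\<in>ring_circ. \<forall>x. s c x \<in> N)"
proof
  assume *: "\<forall>P. minimal_prime P \<longrightarrow> loc s P N = loc s P UNIV"
  obtain G where G: "finite G" "module.span s G = UNIV" using assms(4) by (auto simp: fin_gen_def)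
  have "\<not> colon s N UNIV \<subseteq> P" if P: "minimal_prime P" for P
  proof -
    note prP = minimal_prime_prime[OF P]
    have "\<exists>u. u \<notin> P \<and> s u x \<in> N" for x
      using * P loc_eq_UNIV_iff[OF assms(3) prP N] by blast
    then obtain u where "u \<notin> P" "\<And>x. s u x \<in> N"
      using common_multiplier[OF assms(3) G prP N] by blast
    then show ?thesis by (auto simp: colon_def)
  qed
  then obtain c where "c \<in> colon s N UNIV" "c \<in> ring_circ"
    using ideal_meets_ring_circ[OF assms(1,2) ring_ideal_colon[OF assms(3) N]] by blast
  then show "\<exists>c\<in>ring_circ. \<forall>x. s c x \<in> N" by (auto simp: colon_def)
next
  assume "\<exists>c\<in>ring_circ. \<forall>x. s c x \<in> N"
  then obtain c where c: "c \<in> ring_circ" "\<And>x. s c x \<in> N" by auto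
  show "\<forall>P. minimal_prime P \<longrightarrow> loc s P N = loc s P UNIV"
  proof (intro allI impI)
    fix P :: "'r set" assume P: "minimal_prime P"
    then have "c \<notin> P" using c(1) by (auto simp: ring_circ_def)
    then show "loc s P N = loc s P UNIV"
      using c(2) loc_eq_UNIV_iff[OF assms(3) minimal_prime_prime[OF P] N] by blast
  qed
qed

section \<open>The tight interior is the smallest generically full compatible submodule\<close>

text \<open>
  A Cartier map is additive but not linear, so to control it on a span it has to be controlled on all
  multiples of the generators.
\<close>

lemma additive_into_subspace:
  assumes "module s" and T: "module.subspace t T" "module t"
    and add: "\<And>x y. \<phi> (x + y) = \<phi> x + \<phi> y"
    and gen: "\<And>a x. x \<in> S \<Longrightarrow> \<phi> (s a x) \<in> T"
    and "x \<in> module.span s S"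
  shows "\<phi> x \<in> T"
proof -
  interpret module s by fact
  have "\<phi> 0 = 0" using add[of 0 0] by simp
  then have "\<phi> 0 \<in> T" using module.subspace_0[OF T(2,1)] by simp
  with assms(6) show ?thesis
    by (induction rule: span_induct_alt) (auto simp: add gen module.subspace_add[OF T(2,1)])
qed

lemma tight_interior_compatible:
  fixes s :: "'r::comm_ring_prime_char \<Rightarrow> 'm::ab_group_add \<Rightarrow> 'm"
  assumes "module s"
  shows "cartier_compatible s (full_cartier s) (tight_interior s)"
proof -
  interpret module s by fact
  note hom_iff = frob_hom_iff[OF assms assms]
  have sub: "subspace (tight_interior s)"
    unfolding tight_interior_def tight_interior_at_def by (intro subspace_Int) auto
  moreover have "\<phi> x \<in> tight_interior s"
    if \<phi>: "module_hom (frob_twist f s) s \<phi>" and x: "x \<in> tight_interior s" for f \<phi> x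
    unfolding tight_interior_def
  proof (intro INT_I)
    fix c :: 'r and e0 assume "c \<in> ring_circ"
    then have "x \<in> tight_interior_at s c e0" using x by (auto simp: tight_interior_def)
    then show "\<phi> x \<in> tight_interior_at s c e0"
      unfolding tight_interior_at_def
    proof (rule additive_into_subspace[OF assms subspace_span assms, rotated 2])
      show "\<phi> (x + y) = \<phi> x + \<phi> y" for x y using \<phi> by (simp add: hom_iff)
      fix a y assume "y \<in> (\<Union>e\<in>{e0..}. {g c |g. module_hom (frob_twist e (*)) s g})"
      then obtain e g where g: "e0 \<le> e" "module_hom (frob_twist e (*)) s g" "y = g c" by auto
      have "module_hom (frob_twist (e + f) (*)) s (\<lambda>r. \<phi> (s a (g r)))"
        by (rule frob_hom_compose[OF module_mult assms assms
              frob_hom_scale[OF module_mult assms g(2)] \<phi>])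
      then show "\<phi> (s a y) \<in> span (\<Union>e\<in>{e0..}. {g c |g. module_hom (frob_twist e (*)) s g})"
        using g(1) unfolding g(3) by (intro span_base UN_I[of "e + f"]) auto
    qed
  qed
  ultimately show ?thesis
    by (auto simp: cartier_compatible_def full_cartier_def intro: subspace_scale split: if_splits)
qed

lemma cartier_image_scale_tight_interior:
  fixes s :: "'r::comm_ring_prime_char \<Rightarrow> 'm::ab_group_add \<Rightarrow> 'm"
  assumes "module s" and c: "\<And>d e0. d \<in> ring_circ \<Longrightarrow> \<exists>e\<ge>e0. c \<in> cartier_image e d"
  shows "s c x \<in> tight_interior s"
  unfolding tight_interior_def
proof (intro INT_I)
  fix d :: 'r and e0 assume "d \<in> ring_circ"
  then obtain e where e: "e0 \<le> e" "c \<in> cartier_image e d" using c by blast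
  obtain \<phi> where \<phi>: "module_hom (frob_twist e (*)) (*) \<phi>" "\<phi> d = c" using e(2) by (rule cartier_imageE)
  have "module_hom (frob_twist e (*)) s (\<lambda>r. s (\<phi> r) x)"
    by (intro module_pair.module_hom_compose_scale module_pair.intro module_frob_twist module_mult assms(1) \<phi>(1))
  then show "s c x \<in> tight_interior_at s d e0"
    unfolding tight_interior_at_def using e(1) \<phi>(2)
    by (intro module.span_base[OF assms(1)] UN_I[of e]) auto
qed

definition trace_ideal :: "('r::comm_ring_1 \<Rightarrow> 'm::ab_group_add \<Rightarrow> 'm) \<Rightarrow> 'r set" where
  "trace_ideal s = module.span (*) {h x |h x. module_hom s (*) h}"

text \<open>
  By the generic dual basis, \<open>c M\<close> is contained in the trace ideal times \<open>M\<close>. If a minimal prime \<open>P\<close>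
  contained the trace ideal, then \<open>v c M = 0\<close> for an element \<open>v \<notin> P\<close> that kills \<open>P\<close>, contrary to \<open>P\<close>
  being in the support.
\<close>

lemma trace_ideal_meets_ring_circ:
  fixes s :: "'r::comm_ring_1 \<Rightarrow> 'm::ab_group_add \<Rightarrow> 'm"
  assumes noeth: "noetherian TYPE('r)" and red: "reduced TYPE('r)"
    and "module s" "fin_gen s UNIV" and supp: "module_supp s = {P. ring_prime P}"
  obtains d where "d \<in> trace_ideal s" "d \<in> ring_circ"
proof -
  interpret module s by fact
  obtain c G \<phi> where c: "c \<in> ring_circ" "\<And>b. module_hom s (*) (\<phi> b)"
    "\<And>x. s c x = (\<Sum>b\<in>G. s (\<phi> b x) b)"
    by (rule generic_dual_basis[OF noeth red \<open>module s\<close> assms(4)]) (rule that; assumption)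
  have "\<not> trace_ideal s \<subseteq> P" if P: "minimal_prime P" for P
  proof
    assume T: "trace_ideal s \<subseteq> P"
    note prP = minimal_prime_prime[OF P]
    obtain v where v: "v \<notin> P" "\<forall>a\<in>P. v * a = 0"
      using minimal_prime_annihilated[OF noeth red P] by auto
    obtain x where x: "\<And>u. u \<notin> P \<Longrightarrow> s u x \<noteq> 0" using supp_witness[OF \<open>module s\<close> supp prP] by blast
    have "\<phi> b x \<in> trace_ideal s" for b
      unfolding trace_ideal_def using c(2) by (intro module.span_base[OF module_mult]) blast
    then have "v * \<phi> b x = 0" for b using v(2) T by auto
    then have "s v (s c x) = 0" by (simp only: c(3) scale_sum_right) simp
    then have "s (v * c) x = 0" by simp
    moreover have "v * c \<notin> P" using v(1) c(1) P by (intro ring_prime_mult_notin[OF prP]) (auto simp: ring_circ_def)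
    ultimately show False using x by blast
  qed
  moreover have "ring_ideal (trace_ideal s)"
    unfolding trace_ideal_def by (rule module.subspace_span[OF module_mult])
  ultimately show ?thesis using ideal_meets_ring_circ[OF noeth red] that by blast
qed

text \<open>
  Maps out of \<open>\<^sup>eR\<close> are compared with Cartier operators on \<open>M\<close>: for \<open>h : M \<rightarrow> R\<close> the composition \<open>g \<circ> h\<close>
  is such an operator, and \<open>g(c h(x)) = (g \<circ> h)(c x)\<close> with \<open>c x \<in> N\<close>.
\<close>

lemma frob_hom_trace_ideal:
  fixes s :: "'r::comm_ring_prime_char \<Rightarrow> 'm::ab_group_add \<Rightarrow> 'm"
  assumes "module s" and N': "module.subspace s N'"
    and \<phi>: "\<And>\<phi> x. module_hom (frob_twist e s) s \<phi> \<Longrightarrow> x \<in> N \<Longrightarrow> \<phi> x \<in> N'"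
    and c: "\<And>x. s c x \<in> N" and d: "d \<in> trace_ideal s" and g: "module_hom (frob_twist e (*)) s g"
  shows "g (c * d) \<in> N'"
proof (rule additive_into_subspace[OF module_mult N' \<open>module s\<close> _ _ d[unfolded trace_ideal_def]])
  interpret module s by fact
  show "g (c * (x + y)) = g (c * x) + g (c * y)" for x y
    using g by (simp add: frob_hom_iff[OF module_mult \<open>module s\<close>] distrib_left)
  fix a y :: 'r assume "y \<in> {h x |h x. module_hom s (*) h}"
  then obtain h x where h: "module_hom s (*) h" "y = h x" by auto
  have "module_hom (frob_twist (0 + e) s) s (\<lambda>x. g (h x))"
    using h(1) by (intro frob_hom_compose[OF \<open>module s\<close> module_mult \<open>module s\<close> _ g]) (simp add: frob_twist_0)
  then have "g (h (s c (s a x))) \<in> N'" using \<phi>[of "\<lambda>x. g (h x)" "s c (s a x)"] c[of "s a x"] by simp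
  moreover have "h (s c (s a x)) = c * (a * y)" using h by (simp add: module_hom_iff mult.assoc)
  ultimately show "g (c * (a * y)) \<in> N'" by simp
qed

lemma tight_interior_least:
  fixes s :: "'r::comm_ring_prime_char \<Rightarrow> 'm::ab_group_add \<Rightarrow> 'm"
  assumes "module s" and N: "cartier_compatible s (full_cartier s) N"
    and c: "c \<in> ring_circ" "\<And>x. s c x \<in> N" and d: "d \<in> trace_ideal s" "d \<in> ring_circ"
  shows "tight_interior s \<subseteq> N"
proof -
  have sub: "module.subspace s N" using N by (simp add: cartier_compatible_def)
  have \<phi>: "\<phi> x \<in> N" if "module_hom (frob_twist e s) s \<phi>" "1 \<le> e" "x \<in> N" for e \<phi> x
  proof -
    have "\<phi> \<in> full_cartier s e" using that by (auto simp: full_cartier_def)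
    then show ?thesis using N that(3) unfolding cartier_compatible_def by blast
  qed
  have "tight_interior s \<subseteq> tight_interior_at s (c * d) 1"
    unfolding tight_interior_def using ring_circ_mult[OF c(1) d(2)] by blast
  also have "\<dots> \<subseteq> N"
    unfolding tight_interior_at_def
  proof (rule module.span_minimal[OF \<open>module s\<close> _ sub], safe)
    fix e g assume e: "1 \<le> e" and g: "module_hom (frob_twist e (*)) s g"
    show "g (c * d) \<in> N"
      by (rule frob_hom_trace_ideal[OF \<open>module s\<close> sub _ c(2) d(1) g], rule \<phi>[OF _ e])
  qed
  finally show ?thesis .
qed

text \<open>
  Every step of the chain stays generically full. The map \<open>r \<mapsto> \<psi>(r) x\<close> from \<open>\<^sup>1R\<close> to \<open>M\<close> sends \<open>(c d)\<^sup>p\<close>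
  to \<open>c d \<psi>(1) x\<close>, and \<open>frob_hom_trace_ideal\<close> applies to it because \<open>(c d)\<^sup>p\<close> is \<open>d\<close> times a multiple
  of \<open>c\<close>.
\<close>

lemma Cplus_generically_full:
  fixes s :: "'r::comm_ring_prime_char \<Rightarrow> 'm::ab_group_add \<Rightarrow> 'm"
  assumes "module s" and \<psi>: "module_hom (frob_twist 1 (*)) (*) \<psi>"
    and c: "\<And>x. s c x \<in> N" and d: "d \<in> trace_ideal s"
  shows "s (c * d * \<psi> 1) x \<in> Cplus s N"
proof -
  interpret module s by fact
  let ?p = "CHAR('r)"
  define a where "a = c * (c * d) ^ (?p - 1)"
  have a: "s a y \<in> N" for y using c[of "s ((c * d) ^ (?p - 1)) y"] by (simp add: a_def)
  have hom: "module_hom (frob_twist 1 (*)) s (\<lambda>r. s (\<psi> r) x)"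
    by (intro module_pair.module_hom_compose_scale module_pair.intro module_frob_twist module_mult \<open>module s\<close> \<psi>)
  have "s (\<psi> (a * d)) x \<in> Cplus s N"
    by (rule frob_hom_trace_ideal[OF \<open>module s\<close> subspace_Cplus[OF \<open>module s\<close>] _ a d hom])
       (rule Cplus_base[OF \<open>module s\<close>], auto)
  moreover have "a * d = (c * d) ^ ?p * 1"
    using power_minus_mult[of ?p "c * d"] by (simp add: a_def mult_ac)
  moreover have "\<psi> ((c * d) ^ ?p * 1) = c * d * \<psi> 1"
    using \<psi>[unfolded frob_hom_iff[OF module_mult module_mult], THEN conjunct2, rule_format, of "c * d" 1]
    by simp
  ultimately show ?thesis by simp
qed

theorem theorem5p6:
  fixes s :: "'r::comm_ring_prime_char \<Rightarrow> 'm::ab_group_add \<Rightarrow> 'm"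
  assumes "noetherian TYPE('r)"
    and "F_finite TYPE('r)"
    and "reduced TYPE('r)"
    and "module s"
    and "fin_gen s UNIV"
    and "module_supp s = {P. ring_prime P}"
  shows "(\<exists>!N. is_test_submodule s (full_cartier s) N) \<and>
         tight_interior s = test_submodule s (full_cartier s)"
proof -
  let ?C = "full_cartier s"
  obtain c :: 'r where c: "c \<in> ring_circ"
    "\<And>d e0. d \<in> ring_circ \<Longrightarrow> \<exists>e\<ge>e0. c \<in> cartier_image e d"
    "\<exists>\<psi>. module_hom (frob_twist 1 (*)) (*) \<psi> \<and> \<psi> 1 = c"
    by (rule test_element[OF assms(1,3,2)]) (rule that; assumption)
  obtain \<psi> where \<psi>: "module_hom (frob_twist 1 (*)) (*) \<psi>" "\<psi> 1 = c" using c(3) by auto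
  obtain d where d: "d \<in> trace_ideal s" "d \<in> ring_circ"
    by (rule trace_ideal_meets_ring_circ[OF assms(1,3,4,5,6)]) (rule that; assumption)
  note full_iff = generic_equality_iff_ring_circ[OF assms(1,3,4,5)]
  have "\<exists>b\<in>ring_circ. \<forall>x. s b x \<in> (Cplus s ^^ n) UNIV" for n
  proof (induction n)
    case 0
    show ?case using ring_circ_one by auto
  next
    case (Suc n)
    then obtain b where b: "b \<in> ring_circ" "\<And>x. s b x \<in> (Cplus s ^^ n) UNIV" by auto
    have "\<forall>x. s (b * d * c) x \<in> (Cplus s ^^ Suc n) UNIV"
      using Cplus_generically_full[OF assms(4) \<psi>(1) b(2) d(1)] \<psi>(2) by simp
    then show ?case using b(1) c(1) d(2) by (blast intro: ring_circ_mult)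
  qed
  moreover obtain n where n: "cartier_stable s ?C = (Cplus s ^^ n) UNIV"
    by (rule cartier_stable_eq[OF assms(1,4,5)])
  moreover have "module.subspace s ((Cplus s ^^ n) UNIV)"
    using subspace_Cplus[OF assms(4)] module.subspace_UNIV[OF assms(4)] by (cases n) auto
  ultimately have "loc s P (cartier_stable s ?C) = loc s P UNIV" if "minimal_prime P" for P
    using full_iff that by metis
  then have gen: "generically_stable s ?C N \<longleftrightarrow> (\<exists>b\<in>ring_circ. \<forall>x. s b x \<in> N)"
    if "module.subspace s N" for N
    using full_iff[OF that] min_assoc_primes_full_support[OF assms(1,3,4,6)]
    by (auto simp: generically_stable_def)
  have "is_test_submodule s ?C (tight_interior s)"
    unfolding is_test_submodule_def
  proof (intro conjI allI impI)
    show compat: "cartier_compatible s ?C (tight_interior s)" by (rule tight_interior_compatible[OF assms(4)])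
    have "\<forall>x. s c x \<in> tight_interior s" using cartier_image_scale_tight_interior[OF assms(4) c(2)] by blast
    then show "generically_stable s ?C (tight_interior s)"
      using gen c(1) compat by (auto simp: cartier_compatible_def)
    fix N assume N: "cartier_compatible s ?C N \<and> generically_stable s ?C N"
    then obtain b where "b \<in> ring_circ" "\<And>x. s b x \<in> N"
      using gen[of N] by (auto simp: cartier_compatible_def)
    then show "tight_interior s \<subseteq> N" using tight_interior_least[OF assms(4) _ _ _ d] N by blast
  qed
  moreover have "N = N'" if "is_test_submodule s ?C N" "is_test_submodule s ?C N'" for N N'
    using that by (auto simp: is_test_submodule_def)
  ultimately have unique: "\<exists>!N. is_test_submodule s ?C N" by blast
  moreover have "test_submodule s ?C = tight_interior s"
    unfolding test_submodule_def by (rule the1_equality[OF unique]) fact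
  ultimately show ?thesis by simp
qed

end
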